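(* Let $K$ be a field, let $G$ be a nontrivial finite group with identity element $e$, and let $\mu:G\to\mathbb{Z}_{>0}$ be the constant function $\mu\equiv 1$. If $\Gamma\in\mathscr{G}_{(G,\mu)}$, then $$\dim_K Z(\Lambda_\Gamma)=\mathrm{occ}_G(e),$$ where $Z(\Lambda_\Gamma)$ is the center of $\Lambda_\Gamma$.
   Context: Subgroup-occurrence: $\mathrm{occ}_G(x):=|\{H\leqslant G\mid x\in H\}|$ (so $\mathrm{occ}_G(e)$ is the number of subgroups of $G$). Brauer configurations. A Brauer configuration is a quadruple $\Gamma=(\Gamma_0,\Gamma_1,\mu,\mathfrak{o})$ where: $\Gamma_0$ is a finite set (vertices); $\Gamma_1$ is a finite collection of finite labeled multisets of elements of $\Gamma_0$ (polygons; differently labeled polygons may have the same elements); $\mu:\Gamma_0\to\mathbb{Z}_{>0}$ is a function (multiplicity). For $\alpha\in\Gamma_0$, $V\in\Gamma_1$, $\mathrm{occ}(\alpha,V)$ is the number of times $\alpha$ occurs in $V$, and $\mathrm{val}(\alpha)=\sum_{V\in\Gamma_1}\mathrm{occ}(\alpha,V)$. A vertex $\alpha$ is truncated if $\mathrm{val}(\alpha)=\mu(\alpha)=1$. The orientation $\mathfrak{o}$ is a choice, for each nontruncated vertex $\alpha$, of a cyclic ordering $V_{i_1}<\cdots<V_{i_t}(<V_{i_1})$, $t=\mathrm{val}(\alpha)$, of the list of polygons containing $\alpha$, in which each $V$ appears $\mathrm{occ}(\alpha,V)$ times (the successor sequence at $\alpha$). It is required that: (C1) every vertex occurs in at least one polygon;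 (C2) every polygon has at least two vertices (counted with repetition); (C3) every polygon contains a vertex $\alpha$ with $\mathrm{val}(\alpha)\mu(\alpha)>1$. $\overline{V}$ denotes the set of vertices occurring in $V$. Quiver and algebra. The quiver $\mathcal{Q}$ induced by $\Gamma$ has one vertex $v$ for each polygon $V$, and for each nontruncated $\alpha$ with successor sequence $V_{i_1}<\cdots<V_{i_t}$ it has $t$ arrows $a^{(\alpha)}_j:v_{i_j}\to v_{i_{j+1}}$ ($1\le j\le t$, $i_{t+1}=i_1$), all arrows for different $\alpha$ or different $j$ being distinct. Paths are written from left to right. The special $\alpha$-cycles are $C_l=a^{(\alpha)}_l\cdots a^{(\alpha)}_t a^{(\alpha)}_1\cdots a^{(\alpha)}_{l-1}$, $1\le l\le t$; those starting (and ending) at $v$ are the special $\alpha$-cycles at $v$. For a field $K$, the Brauer configuration algebra is $\Lambda_\Gamma=K\mathcal{Q}/I$ where $I$ is generated by: (type one) $C^{\mu(\alpha)}-D^{\mu(\beta)}$ for every polygon $V$, all nontruncated $\alpha,\beta\in\overline{V}$, and all special $\alpha$-cycles $C$ and special $\beta$-cycles $D$ at $v$; (type two) $C^{\mu(\alpha)}f(C)$ for every nontruncated $\alpha$ and special $\alpha$-cycle $C$, where $f(C)$ is the first arrow of $C$; (type three) all paths $ab$ of length two that are not subpaths of any special cycle, except the squares $aa$ where $a$ is the loop induced by a vertex $\alpha$ with $\mathrm{val}(\alpha)=1$ and $\mu(\alpha)>1$. The class $\mathscr{G}_{(G,\mu)}$ for $\mu\equiv1$. If $|G|$ is not a prime number,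 $\mathscr{G}_{(G,\mu)}$ is the class of all Brauer configurations $\Gamma=(\Gamma_0,\Gamma_1,\mu,\mathfrak{o})$ with $\Gamma_0=G$, $\Gamma_1=\{H\mid H\leqslant G,\ H\neq\{e\}\}$, the given $\mu$, and $\mathfrak{o}$ any orientation; $\Lambda_\Gamma$ is then the Brauer configuration algebra of $\Gamma$ over $K$. If $|G|$ is prime, $\mathscr{G}_{(G,\mu)}$ consists of the single configuration $\Gamma$ with $\Gamma_0=G$, $\Gamma_1=\{G\}$ (which is not a Brauer configuration since (C3) fails), and one sets $\Lambda_\Gamma:=K[x]/(x^2)$. *)

theory Defs
  imports
    "HOL-Algebra.Algebra"
    "HOL-Library.Multiset"
    "HOL-Library.Sublist"
    "Graph_Theory.Arc_Walk"
begin

section \<open>Algebras over a field\<close>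

text \<open>A \<open>K\<close>-algebra is represented by a \<open>module\<close> record over \<open>K\<close> (a ring together with a scalar
  multiplication); it need not be commutative.\<close>

definition quotient_algebra :: "('k, 'b, 'm) module_scheme \<Rightarrow> 'b set \<Rightarrow> ('k, 'b set) module"
  where "quotient_algebra A I =
    \<lparr>carrier = carrier (A Quot I), monoid.mult = monoid.mult (A Quot I), one = monoid.one (A Quot I),
     ring.zero = ring.zero (A Quot I), add = ring.add (A Quot I),
     smult = (\<lambda>c Y. \<Union>y\<in>Y. I +>\<^bsub>A\<^esub> (c \<odot>\<^bsub>A\<^esub> y))\<rparr>"

definition algebra_center :: "('b, 'm) ring_scheme \<Rightarrow> 'b set"
  where "algebra_center A =
    {z \<in> carrier A. \<forall>x\<in>carrier A. z \<otimes>\<^bsub>A\<^esub> x = x \<otimes>\<^bsub>A\<^esub> z}"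

definition scalars :: "('k, 'l) ring_scheme \<Rightarrow> ('k, 'b, 'm) module_scheme \<Rightarrow> 'b set"
  where "scalars K A = (\<lambda>c. c \<odot>\<^bsub>A\<^esub> \<one>\<^bsub>A\<^esub>) ` carrier K"

text \<open>The library's \<open>dimension\<close> is taken over a subfield of the ambient ring, here the copy
  \<open>K \<cdot> 1\<close> of \<open>K\<close> in \<open>A\<close>; it is a relation because the dimension may be infinite.\<close>

definition has_dim :: "('k, 'l) ring_scheme \<Rightarrow> ('k, 'b, 'm) module_scheme \<Rightarrow> 'b set \<Rightarrow> nat \<Rightarrow> bool"
  where "has_dim K A E n \<longleftrightarrow> ring.dimension A n (scalars K A) E"


section \<open>Path algebras\<close>

text \<open>A quiver is a \<open>pre_digraph\<close> (multiple arrows and loops allowed). A path is a pair of its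
  starting vertex and its list of arrows, read from left to right; \<open>(v, [])\<close> is the trivial path
  at \<open>v\<close>.\<close>

definition quiver_paths :: "('v, 'e) pre_digraph \<Rightarrow> ('v \<times> 'e list) set"
  where "quiver_paths Q = {(u, p). \<exists>v. pre_digraph.awalk Q u p v}"

text \<open>Elements are coefficient functions with finite support contained in the set of paths. The
  coefficient of a product at a path sums over all ways of cutting that path in two.\<close>

definition path_algebra ::
    "('k, 'l) ring_scheme \<Rightarrow> ('v, 'e) pre_digraph \<Rightarrow> ('k, 'v \<times> 'e list \<Rightarrow> 'k) module"
  where "path_algebra K Q =
    \<lparr>carrier = {f. range f \<subseteq> carrier K \<and> finite {p. f p \<noteq> \<zero>\<^bsub>K\<^esub>} \<and>
                   {p. f p \<noteq> \<zero>\<^bsub>K\<^esub>} \<subseteq> quiver_paths Q},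
     monoid.mult = (\<lambda>f g (u, p). \<Oplus>\<^bsub>K\<^esub>i\<in>{..length p}.
       f (u, take i p) \<otimes>\<^bsub>K\<^esub> g (pre_digraph.awlast Q u (take i p), drop i p)),
     one = (\<lambda>(u, p). if u \<in> verts Q \<and> p = [] then \<one>\<^bsub>K\<^esub> else \<zero>\<^bsub>K\<^esub>),
     ring.zero = (\<lambda>_. \<zero>\<^bsub>K\<^esub>),
     add = (\<lambda>f g q. f q \<oplus>\<^bsub>K\<^esub> g q),
     smult = (\<lambda>c f q. c \<otimes>\<^bsub>K\<^esub> f q)\<rparr>"

definition path_elt :: "('k, 'l) ring_scheme \<Rightarrow> 'v \<times> 'e list \<Rightarrow> ('v \<times> 'e list \<Rightarrow> 'k)"
  where "path_elt K p = (\<lambda>q. if q = p then \<one>\<^bsub>K\<^esub> else \<zero>\<^bsub>K\<^esub>)"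


section \<open>Brauer configurations\<close>

text \<open>The labels of the polygons are the elements of \<open>polygons\<close>, and \<open>elts V\<close> is the multiset
  labelled by \<open>V\<close>. The successor sequence at a vertex is stored as a list, that is, as a cyclic
  ordering together with a choice of where it starts; its values at truncated vertices are
  irrelevant.\<close>

record ('a, 'i) brauer_config =
  vertices :: "'a set"
  polygons :: "'i set"
  elts :: "'i \<Rightarrow> 'a multiset"
  mu :: "'a \<Rightarrow> nat"
  succ_seq :: "'a \<Rightarrow> 'i list"

definition val :: "('a, 'i, 'm) brauer_config_scheme \<Rightarrow> 'a \<Rightarrow> nat"
  where "val \<Gamma> \<alpha> = (\<Sum>V\<in>polygons \<Gamma>. count (elts \<Gamma> V) \<alpha>)"

definition truncated :: "('a, 'i, 'm) brauer_config_scheme \<Rightarrow> 'a \<Rightarrow> bool"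
  where "truncated \<Gamma> \<alpha> \<longleftrightarrow> val \<Gamma> \<alpha> = 1 \<and> mu \<Gamma> \<alpha> = 1"

definition nontruncated :: "('a, 'i, 'm) brauer_config_scheme \<Rightarrow> 'a set"
  where "nontruncated \<Gamma> = {\<alpha> \<in> vertices \<Gamma>. \<not> truncated \<Gamma> \<alpha>}"

locale brauer_configuration =
  fixes \<Gamma> :: "('a, 'i, 'm) brauer_config_scheme"
  assumes finite_vertices: "finite (vertices \<Gamma>)"
    and finite_polygons: "finite (polygons \<Gamma>)"
    and elts_vertices: "\<And>V. V \<in> polygons \<Gamma> \<Longrightarrow> set_mset (elts \<Gamma> V) \<subseteq> vertices \<Gamma>"
    and mu_pos: "\<And>\<alpha>. \<alpha> \<in> vertices \<Gamma> \<Longrightarrow> mu \<Gamma> \<alpha> > 0"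
    and orientation: "\<And>\<alpha>. \<alpha> \<in> nontruncated \<Gamma> \<Longrightarrow>
      mset (succ_seq \<Gamma> \<alpha>) = (\<Sum>V\<in>polygons \<Gamma>. replicate_mset (count (elts \<Gamma> V) \<alpha>) V)"
    and C1: "\<And>\<alpha>. \<alpha> \<in> vertices \<Gamma> \<Longrightarrow> \<exists>V\<in>polygons \<Gamma>. \<alpha> \<in># elts \<Gamma> V"
    and C2: "\<And>V. V \<in> polygons \<Gamma> \<Longrightarrow> size (elts \<Gamma> V) \<ge> 2"
    and C3: "\<And>V. V \<in> polygons \<Gamma> \<Longrightarrow> \<exists>\<alpha>. \<alpha> \<in># elts \<Gamma> V \<and> val \<Gamma> \<alpha> * mu \<Gamma> \<alpha> > 1"


section \<open>Brauer configuration algebras\<close>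

text \<open>The arrow \<open>(\<alpha>, j)\<close> leads from the polygon at position \<open>j\<close> of the successor sequence at \<open>\<alpha>\<close>
  (counted from \<open>0\<close>) to the next one, cyclically.\<close>

definition brauer_quiver :: "('a, 'i, 'm) brauer_config_scheme \<Rightarrow> ('i, 'a \<times> nat) pre_digraph"
  where "brauer_quiver \<Gamma> =
    \<lparr>verts = polygons \<Gamma>,
     arcs = {(\<alpha>, j). \<alpha> \<in> nontruncated \<Gamma> \<and> j < val \<Gamma> \<alpha>},
     tail = (\<lambda>(\<alpha>, j). succ_seq \<Gamma> \<alpha> ! j),
     head = (\<lambda>(\<alpha>, j). succ_seq \<Gamma> \<alpha> ! (Suc j mod val \<Gamma> \<alpha>))\<rparr>"

definition special_cycle ::
    "('a, 'i, 'm) brauer_config_scheme \<Rightarrow> 'a \<Rightarrow> nat \<Rightarrow> 'i \<times> ('a \<times> nat) list"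
  where "special_cycle \<Gamma> \<alpha> l =
    (succ_seq \<Gamma> \<alpha> ! l, rotate l (map (Pair \<alpha>) [0..<val \<Gamma> \<alpha>]))"

definition first_arrow :: "'i \<times> 'e list \<Rightarrow> 'i \<times> 'e list"
  where "first_arrow C = (fst C, [hd (snd C)])"

text \<open>The set of pairs \<open>(\<alpha>, C)\<close> with \<open>\<alpha>\<close> nontruncated and \<open>C\<close> a special \<open>\<alpha>\<close>-cycle.\<close>

definition special_cycles ::
    "('a, 'i, 'm) brauer_config_scheme \<Rightarrow> ('a \<times> ('i \<times> ('a \<times> nat) list)) set"
  where "special_cycles \<Gamma> =
    {(\<alpha>, special_cycle \<Gamma> \<alpha> l) | \<alpha> l. \<alpha> \<in> nontruncated \<Gamma> \<and> l < val \<Gamma> \<alpha>}"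

definition cycle_power ::
    "('k, 'l) ring_scheme \<Rightarrow> ('a, 'i, 'm) brauer_config_scheme \<Rightarrow>
     'a \<Rightarrow> 'i \<times> ('a \<times> nat) list \<Rightarrow> ('i \<times> ('a \<times> nat) list \<Rightarrow> 'k)"
  where "cycle_power K \<Gamma> \<alpha> C =
    path_elt K C [^]\<^bsub>path_algebra K (brauer_quiver \<Gamma>)\<^esub> mu \<Gamma> \<alpha>"

definition relations_one ::
    "('k, 'l) ring_scheme \<Rightarrow> ('a, 'i, 'm) brauer_config_scheme \<Rightarrow>
     ('i \<times> ('a \<times> nat) list \<Rightarrow> 'k) set"
  where "relations_one K \<Gamma> =
    {cycle_power K \<Gamma> \<alpha> C \<ominus>\<^bsub>path_algebra K (brauer_quiver \<Gamma>)\<^esub> cycle_power K \<Gamma> \<beta> D | V \<alpha> \<beta> C D.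
      V \<in> polygons \<Gamma> \<and> \<alpha> \<in># elts \<Gamma> V \<and> \<beta> \<in># elts \<Gamma> V \<and>
      (\<alpha>, C) \<in> special_cycles \<Gamma> \<and> (\<beta>, D) \<in> special_cycles \<Gamma> \<and> fst C = V \<and> fst D = V}"

definition relations_two ::
    "('k, 'l) ring_scheme \<Rightarrow> ('a, 'i, 'm) brauer_config_scheme \<Rightarrow>
     ('i \<times> ('a \<times> nat) list \<Rightarrow> 'k) set"
  where "relations_two K \<Gamma> =
    {cycle_power K \<Gamma> \<alpha> C \<otimes>\<^bsub>path_algebra K (brauer_quiver \<Gamma>)\<^esub> path_elt K (first_arrow C) | \<alpha> C.
      (\<alpha>, C) \<in> special_cycles \<Gamma>}"

definition relations_three ::
    "('k, 'l) ring_scheme \<Rightarrow> ('a, 'i, 'm) brauer_config_scheme \<Rightarrow>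
     ('i \<times> ('a \<times> nat) list \<Rightarrow> 'k) set"
  where "relations_three K \<Gamma> =
    {path_elt K (u, [a, b]) | u a b.
      (u, [a, b]) \<in> quiver_paths (brauer_quiver \<Gamma>) \<and>
      (\<forall>(\<alpha>, C) \<in> special_cycles \<Gamma>. \<not> sublist [a, b] (snd C)) \<and>
      \<not> (a = b \<and> (\<exists>\<alpha>\<in>nontruncated \<Gamma>. val \<Gamma> \<alpha> = 1 \<and> mu \<Gamma> \<alpha> > 1 \<and> a = (\<alpha>, 0)))}"

definition brauer_algebra ::
    "('k, 'l) ring_scheme \<Rightarrow> ('a, 'i, 'm) brauer_config_scheme \<Rightarrow>
     ('k, ('i \<times> ('a \<times> nat) list \<Rightarrow> 'k) set) module"
  where "brauer_algebra K \<Gamma> =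
    quotient_algebra (path_algebra K (brauer_quiver \<Gamma>))
      (Idl\<^bsub>path_algebra K (brauer_quiver \<Gamma>)\<^esub>
        (relations_one K \<Gamma> \<union> relations_two K \<Gamma> \<union> relations_three K \<Gamma>))"


section \<open>The configurations attached to a finite group\<close>

definition subgroup_occ :: "('a, 'n) monoid_scheme \<Rightarrow> 'a \<Rightarrow> nat"
  where "subgroup_occ G x = card {H. subgroup H G \<and> x \<in> H}"

text \<open>In the prime case the only nontrivial subgroup is \<open>G\<close>, so the same data \<open>\<Gamma>\<^sub>0\<close>, \<open>\<Gamma>\<^sub>1\<close> is
  prescribed, but condition \<open>C3\<close> fails for \<open>\<mu> = 1\<close> and there is no orientation to choose.
  This definition is meant for \<open>\<mu> = 1\<close> only.\<close>

definition group_configs ::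
    "('a, 'n) monoid_scheme \<Rightarrow> ('a \<Rightarrow> nat) \<Rightarrow> ('a, 'a set) brauer_config set"
  where "group_configs G \<mu> =
    {\<Gamma>. vertices \<Gamma> = carrier G \<and>
        polygons \<Gamma> = (if Factorial_Ring.prime (order G) then {carrier G}
                      else {H. subgroup H G \<and> H \<noteq> {\<one>\<^bsub>G\<^esub>}}) \<and>
        (\<forall>H\<in>polygons \<Gamma>. elts \<Gamma> H = mset_set H) \<and>
        (\<forall>x\<in>carrier G. mu \<Gamma> x = \<mu> x) \<and>
        (\<not> Factorial_Ring.prime (order G) \<longrightarrow> brauer_configuration \<Gamma>)}"

text \<open>\<open>K[x]/(x\<^sup>2)\<close>, which is by convention the algebra of the configuration when \<open>|G|\<close> is prime.\<close>

definition poly_mod_square :: "('k, 'l) ring_scheme \<Rightarrow> ('k, (nat \<Rightarrow> 'k) set) module"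
  where "poly_mod_square K =
    quotient_algebra (UP K) (Idl\<^bsub>UP K\<^esub> {up_ring.monom (UP K) \<one>\<^bsub>K\<^esub> 2})"

end

theory Submission
  imports Defs
begin

text \<open>For \<open>\<mu> = 1\<close> every polygon meets a given vertex at most once, and the identity \<open>e\<close> lies in all of
  them. A path survives in the Brauer configuration algebra only if it is \<^emph>\<open>short\<close> (trivial, or a
  proper piece of a special cycle) or a special cycle, and all special cycles at one polygon are
  identified; so the ideal of relations consists of the elements that vanish on short paths and
  whose coefficients at the special cycles at each polygon add up to zero. Every element vanishing on
  short paths is central modulo this ideal. Conversely, commuting with trivial paths kills the
  coefficients of a central element at nontrivial short paths, since successor sequences have no
  repetitions, and commuting with the arrows induced by \<open>e\<close> makes its coefficients at the trivial
  paths equal. Hence the center has as a basis the unit and one special cycle per polygon.\<close>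

section \<open>Dimensions of subspaces of a quotient algebra\<close>

text \<open>The difficulty is to bound the ideal of relations from above. It is therefore compared
  with \<open>J\<close>, which is cut out by linear conditions that make the independence of the
  basis visible. One fact explains both why \<open>J\<close> is an ideal and why elements vanishing
  on short paths are central modulo it: every proper piece of a special cycle is short. So if
  \<open>f\<close> vanishes on short paths, only one cut of a special cycle at \<open>V\<close>
  contributes to the product of \<open>f\<close> and \<open>g\<close>, the one that reads
  \<open>g\<close> at the trivial path of \<open>V\<close>; as the cycle starts and ends at
  \<open>V\<close>, both orders of the factors give the same value. Because \<mu> = 1, nontruncated
  vertices lie in at least two polygons, so every arrow is short and none is a loop. The vertex
  \<open>e\<close> has exactly one special cycle at each polygon, which serves as representative of
  all special cycles there, and its successor sequence runs through all polygons, which links the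
  trivial paths. In the final count the unit corresponds to the trivial subgroup and the special
  cycles to the others.\<close>

locale assoc_algebra = K: cring K + ring A
  for K :: "('k, 'l) ring_scheme" and A :: "('k, 'b, 'm) module_scheme" (structure) +
  assumes smult_closed [simp, intro]:
      "\<lbrakk>c \<in> carrier K; x \<in> carrier A\<rbrakk> \<Longrightarrow> c \<odot> x \<in> carrier A"
    and smult_add_left:
      "\<lbrakk>c \<in> carrier K; d \<in> carrier K; x \<in> carrier A\<rbrakk> \<Longrightarrow> (c \<oplus>\<^bsub>K\<^esub> d) \<odot> x = c \<odot> x \<oplus> d \<odot> x"
    and smult_one [simp]: "x \<in> carrier A \<Longrightarrow> \<one>\<^bsub>K\<^esub> \<odot> x = x"
    and smult_mult_left:
      "\<lbrakk>c \<in> carrier K; x \<in> carrier A; y \<in> carrier A\<rbrakk> \<Longrightarrow> (c \<odot> x) \<otimes> y = c \<odot> (x \<otimes> y)"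
    and smult_mult_right:
      "\<lbrakk>c \<in> carrier K; x \<in> carrier A; y \<in> carrier A\<rbrakk> \<Longrightarrow> x \<otimes> (c \<odot> y) = c \<odot> (x \<otimes> y)"
begin

lemma smult_eq: "\<lbrakk>c \<in> carrier K; x \<in> carrier A\<rbrakk> \<Longrightarrow> c \<odot> x = (c \<odot> \<one>) \<otimes> x"
  by (simp add: smult_mult_left)

text \<open>Scaling by \<open>c\<close> is left multiplication by \<open>c \<odot> \<one>\<close>,
  so additivity in the vector comes from distributivity of the ring.\<close>

lemma smult_add_right:
  assumes "c \<in> carrier K" "x \<in> carrier A" "y \<in> carrier A"
  shows "c \<odot> (x \<oplus> y) = c \<odot> x \<oplus> c \<odot> y"
proof -
  have "(c \<odot> \<one>) \<otimes> (x \<oplus> y) = (c \<odot> \<one>) \<otimes> x \<oplus> (c \<odot> \<one>) \<otimes> y"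
    using assms by (intro r_distr) auto
  then show ?thesis using assms by (simp add: smult_mult_left)
qed

lemma smult_zero_left:
  assumes "x \<in> carrier A" shows "\<zero>\<^bsub>K\<^esub> \<odot> x = \<zero>"
proof -
  have "\<zero>\<^bsub>K\<^esub> \<odot> x \<oplus> \<zero>\<^bsub>K\<^esub> \<odot> x = \<zero>\<^bsub>K\<^esub> \<odot> x"
    using assms smult_add_left[of "\<zero>\<^bsub>K\<^esub>" "\<zero>\<^bsub>K\<^esub>" x] by simp
  then show ?thesis using assms by (simp add: add.l_cancel_one)
qed

lemma smult_minus_left:
  assumes "c \<in> carrier K" "x \<in> carrier A" shows "(\<ominus>\<^bsub>K\<^esub> c) \<odot> x = \<ominus> (c \<odot> x)"
proof -
  have "(\<ominus>\<^bsub>K\<^esub> c) \<odot> x \<oplus> c \<odot> x = \<zero>"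
    using assms smult_add_left[of "\<ominus>\<^bsub>K\<^esub> c" c x] by (simp add: K.l_neg smult_zero_left)
  then show ?thesis using assms by (simp add: minus_equality)
qed

end

locale algebra_ideal = assoc_algebra K A + ideal J A
  for K :: "('k, 'l) ring_scheme" and A :: "('k, 'b, 'm) module_scheme" (structure) and J
begin

abbreviation Q where "Q \<equiv> quotient_algebra A J"

text \<open>The record \<open>Q\<close> adds a scalar multiplication to \<open>A Quot J\<close> but
  copies its ring operations, so each ring axiom transfers by rewriting with
  \<open>eq\<close>.\<close>

lemma quotient_algebra_ring: "ring Q"
proof -
  interpret R: ring "A Quot J" by (rule quotient_is_ring)
  have eq: "carrier Q = carrier (A Quot J)" "monoid.mult Q = monoid.mult (A Quot J)" "one Q = one (A Quot J)"
      "ring.add Q = ring.add (A Quot J)" "ring.zero Q = ring.zero (A Quot J)"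
    by (simp_all add: quotient_algebra_def)
  show ?thesis
  proof (rule ringI)
    show "abelian_group Q"
    proof (rule abelian_groupI)
      fix x assume "x \<in> carrier Q"
      then show "\<exists>y\<in>carrier Q. y \<oplus>\<^bsub>Q\<^esub> x = \<zero>\<^bsub>Q\<^esub>"
        by (intro bexI[of _ "\<ominus>\<^bsub>A Quot J\<^esub> x"]) (simp_all only: eq R.l_neg R.a_inv_closed)
    qed (simp_all only: eq R.a_closed R.zero_closed R.a_assoc R.a_comm R.a_lcomm R.l_zero R.r_zero)
    show "Group.monoid Q"
      by (rule monoidI) (simp_all only: eq R.m_closed R.one_closed R.m_assoc R.l_one R.r_one)
  qed (simp_all only: eq R.l_distr R.r_distr)
qed

lemma smult_mem: "\<lbrakk>c \<in> carrier K; x \<in> J\<rbrakk> \<Longrightarrow> c \<odot> x \<in> J"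
  using I_l_closed[of x "c \<odot> \<one>"] a_subset by (auto simp: smult_mult_left)

section \<open>Computing with cosets\<close>

lemma coset_eq_iff:
  "\<lbrakk>x \<in> carrier A; y \<in> carrier A\<rbrakk> \<Longrightarrow> J +> x = J +> y \<longleftrightarrow> x \<ominus> y \<in> J"
  using quotient_eq_iff_same_a_r_cos[OF ideal_axioms] by auto

lemma quotient_carrier: "carrier Q = (+>) J ` carrier A"
  by (auto simp: quotient_algebra_def FactRing_simps)

lemma quotient_mult:
  "\<lbrakk>x \<in> carrier A; y \<in> carrier A\<rbrakk> \<Longrightarrow> (J +> x) \<otimes>\<^bsub>Q\<^esub> (J +> y) = J +> (x \<otimes> y)"
  by (simp add: quotient_algebra_def FactRing_def rcoset_mult_add)

lemma quotient_add:
  "\<lbrakk>x \<in> carrier A; y \<in> carrier A\<rbrakk> \<Longrightarrow> (J +> x) \<oplus>\<^bsub>Q\<^esub> (J +> y) = J +> (x \<oplus> y)"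
  by (simp add: quotient_algebra_def FactRing_def a_rcos_sum)

text \<open>\<open>smult\<close> of the quotient is a union over all representatives; since
  \<open>J\<close> absorbs scalars, every representative contributes the same coset.\<close>

lemma quotient_smult:
  assumes c: "c \<in> carrier K" and x: "x \<in> carrier A"
  shows "c \<odot>\<^bsub>Q\<^esub> (J +> x) = J +> (c \<odot> x)"
proof -
  have "J +> (c \<odot> y) = J +> (c \<odot> x)" if y: "y \<in> J +> x" for y
  proof -
    obtain j where j: "j \<in> J" "y = j \<oplus> x" using y by (auto simp: a_r_coset_def')
    have "c \<odot> y \<in> J +> (c \<odot> x)"
      using j a_subset smult_mem[OF c j(1)] c x
      by (auto simp: smult_add_right a_r_coset_def')
    then show ?thesis using c x using c x a_subgroup by (metis a_repr_independence smult_closed)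
  qed
  moreover have "x \<in> J +> x" using x by (rule a_rcos_self)
  ultimately have "(\<Union>y\<in>J +> x. J +> (c \<odot> y)) = J +> (c \<odot> x)" by blast
  then show ?thesis by (simp add: quotient_algebra_def)
qed

lemma scalars_quotient: "scalars K Q = (\<lambda>c. J +> (c \<odot> \<one>)) ` carrier K"
proof -
  have "\<one>\<^bsub>Q\<^esub> = J +> \<one>" by (simp add: quotient_algebra_def FactRing_def)
  then show ?thesis by (simp add: scalars_def quotient_smult)
qed

lemma algebra_center_quotient:
  "algebra_center Q = (+>) J ` {z \<in> carrier A. \<forall>x\<in>carrier A. z \<otimes> x \<ominus> x \<otimes> z \<in> J}"
proof -
  have "J +> z \<in> algebra_center Q \<longleftrightarrow> (\<forall>x\<in>carrier A. z \<otimes> x \<ominus> x \<otimes> z \<in> J)" if "z \<in> carrier A" for z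
    using that by (simp add: algebra_center_def quotient_carrier quotient_mult coset_eq_iff)
  moreover have "algebra_center Q \<subseteq> (+>) J ` carrier A"
    by (auto simp: algebra_center_def quotient_carrier)
  ultimately show ?thesis by blast
qed

text \<open>The families \<open>b\<close> and \<open>\<phi>\<close> are dual, and by
  \<open>kernel\<close> the coordinates separate the classes of \<open>M\<close> modulo
  \<open>J\<close>; so the classes of \<open>b\<close> form a basis.\<close>

lemma has_dim_by_coordinates:
  assumes K: "\<one>\<^bsub>K\<^esub> \<noteq> \<zero>\<^bsub>K\<^esub>" and M: "J \<subseteq> M" "M \<subseteq> carrier A"
    and M_add: "\<And>x y. \<lbrakk>x \<in> M; y \<in> M\<rbrakk> \<Longrightarrow> x \<oplus> y \<in> M"
    and M_smult: "\<And>c x. \<lbrakk>c \<in> carrier K; x \<in> M\<rbrakk> \<Longrightarrow> c \<odot> x \<in> M"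
    and I: "finite I"
    and b: "\<And>i. i \<in> I \<Longrightarrow> b i \<in> M"
    and \<phi>: "\<And>i x. \<lbrakk>i \<in> I; x \<in> carrier A\<rbrakk> \<Longrightarrow> \<phi> i x \<in> carrier K"
    and \<phi>_add: "\<And>i x y. \<lbrakk>i \<in> I; x \<in> carrier A; y \<in> carrier A\<rbrakk> \<Longrightarrow> \<phi> i (x \<oplus> y) = \<phi> i x \<oplus>\<^bsub>K\<^esub> \<phi> i y"
    and \<phi>_smult: "\<And>i c x. \<lbrakk>i \<in> I; c \<in> carrier K; x \<in> carrier A\<rbrakk> \<Longrightarrow> \<phi> i (c \<odot> x) = c \<otimes>\<^bsub>K\<^esub> \<phi> i x"
    and dual: "\<And>i j. \<lbrakk>i \<in> I; j \<in> I\<rbrakk> \<Longrightarrow> \<phi> i (b j) = (if i = j then \<one>\<^bsub>K\<^esub> else \<zero>\<^bsub>K\<^esub>)"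
    and kernel: "\<And>x. x \<in> M \<Longrightarrow> x \<in> J \<longleftrightarrow> (\<forall>i\<in>I. \<phi> i x = \<zero>\<^bsub>K\<^esub>)"
  shows "has_dim K Q ((+>) J ` M) (card I)"
proof -
  interpret Q: ring Q by (rule quotient_algebra_ring)
  have ext: "y \<in> Q.line_extension (scalars K Q) v E \<longleftrightarrow>
      (\<exists>c\<in>carrier K. \<exists>e\<in>E. y = (J +> (c \<odot> \<one>)) \<otimes>\<^bsub>Q\<^esub> v \<oplus>\<^bsub>Q\<^esub> e)" for y v E
    by (simp add: Q.line_extension_def scalars_quotient set_add_def set_mult_def r_coset_def)
  \<comment> \<open>The span of the classes of \<open>b i\<close> with \<open>i \<in> F\<close>,
    described by vanishing of the other coordinates. It is zero for \<open>F = {}\<close> and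
    everything for \<open>F = I\<close>, and adding one index is one line extension, as in the
    inductive definition of \<open>dimension\<close>.\<close>
  define E where "E F = (+>) J ` {x \<in> M. \<forall>i\<in>I - F. \<phi> i x = \<zero>\<^bsub>K\<^esub>}" for F
  have "Q.dimension (card F) (scalars K Q) (E F)" if "finite F" "F \<subseteq> I" for F
    using that
  proof (induction F rule: finite_induct)
    case empty
    have "{x \<in> M. \<forall>i\<in>I. \<phi> i x = \<zero>\<^bsub>K\<^esub>} = J" using kernel M by blast
    moreover have "(+>) J ` J = {J}"
    proof -
      have "J +> x = J" if "x \<in> J" for x using that a_subset by (intro a_coset_join2 a_subgroup) auto
      then have "(+>) J ` J = (\<lambda>_. J) ` J" by (rule image_cong[OF refl])
      then show ?thesis using image_constant[of \<zero> J J] by simp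
    qed
    moreover have "\<zero>\<^bsub>Q\<^esub> = J" by (simp add: quotient_algebra_def FactRing_def)
    ultimately have "E {} = {\<zero>\<^bsub>Q\<^esub>}" by (simp only: E_def Diff_empty)
    then show ?case by simp
  next
    case (insert i F)
    then have i: "i \<in> I" and bi: "b i \<in> M" "b i \<in> carrier A" using b M by auto
    \<comment> \<open>\<open>\<phi> i\<close> vanishes on \<open>J\<close> and on some
      representative of every class in \<open>E F\<close>, but takes the value one on
      \<open>b i\<close>.\<close>
    have "J +> b i \<notin> E F"
    proof
      assume "J +> b i \<in> E F"
      then obtain x where x: "x \<in> M" "\<forall>k\<in>I - F. \<phi> k x = \<zero>\<^bsub>K\<^esub>" "J +> b i = J +> x"
        unfolding E_def by blast
      then have x: "x \<in> M" "x \<in> carrier A" "\<phi> i x = \<zero>\<^bsub>K\<^esub>" "b i \<in> J +> x"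
        using insert.hyps i M a_rcos_self[OF bi(2)] by auto
      then obtain j where j: "j \<in> J" "b i = j \<oplus> x" by (auto simp: a_r_coset_def')
      then have "\<phi> i (b i) = \<zero>\<^bsub>K\<^esub>" using kernel[of j] M i x \<phi>_add[OF i, of j x] by auto
      then show False using K dual[OF i i] by simp
    qed
    moreover have "J +> b i \<in> carrier Q" using bi by (auto simp: quotient_carrier)
    ultimately have "Q.dimension (Suc (card F)) (scalars K Q) (Q.line_extension (scalars K Q) (J +> b i) (E F))"
      using insert by (intro Q.Suc_dim) auto
    moreover have "Q.line_extension (scalars K Q) (J +> b i) (E F) = E (insert i F)"
    proof (intro equalityI subsetI)
      fix y assume "y \<in> Q.line_extension (scalars K Q) (J +> b i) (E F)"
      then obtain c x where c: "c \<in> carrier K" and x: "x \<in> M" "\<forall>k\<in>I - F. \<phi> k x = \<zero>\<^bsub>K\<^esub>"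
        and y: "y = (J +> (c \<odot> \<one>)) \<otimes>\<^bsub>Q\<^esub> (J +> b i) \<oplus>\<^bsub>Q\<^esub> (J +> x)"
        unfolding ext E_def by blast
      have "y = J +> (c \<odot> b i \<oplus> x)"
        using y c x M bi by (simp add: quotient_mult quotient_add smult_mult_left subset_iff)
      moreover have "c \<odot> b i \<oplus> x \<in> M" using c x bi M_add M_smult by simp
      moreover have "\<phi> k (c \<odot> b i \<oplus> x) = \<zero>\<^bsub>K\<^esub>" if "k \<in> I - insert i F" for k
        using that c x bi M \<phi>_add[of k "c \<odot> b i" x] \<phi>_smult[of k c "b i"] dual[of k i] i by auto
      ultimately show "y \<in> E (insert i F)" unfolding E_def by blast
    next
      fix y assume "y \<in> E (insert i F)"
      then obtain x where x: "x \<in> M" "x \<in> carrier A" "\<forall>k\<in>I - insert i F. \<phi> k x = \<zero>\<^bsub>K\<^esub>" "y = J +> x"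
        unfolding E_def using M by blast
      define c where "c = \<phi> i x"
      \<comment> \<open>Removing the \<open>i\<close>-th coordinate of \<open>x\<close> leaves an
        element whose class lies in \<open>E F\<close>.\<close>
      define w where "w = x \<oplus> (\<ominus>\<^bsub>K\<^esub> c) \<odot> b i"
      have c: "c \<in> carrier K" using x i \<phi> c_def by simp
      have w: "w \<in> M" "w \<in> carrier A" using M_add M_smult c x bi M by (auto simp: w_def)
      have "\<phi> k w = \<zero>\<^bsub>K\<^esub>" if "k \<in> I - F" for k
        using that c x bi i \<phi>_add[of k x "(\<ominus>\<^bsub>K\<^esub> c) \<odot> b i"] \<phi>_smult[of k "\<ominus>\<^bsub>K\<^esub> c" "b i"] dual[of k i]
        by (cases "k = i") (auto simp: w_def c_def K.r_neg)
      then have "J +> w \<in> E F" using w unfolding E_def by blast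
      moreover have "x = c \<odot> b i \<oplus> w"
        using c x bi by (simp add: w_def smult_minus_left a_lcomm r_neg)
      then have "y = (J +> (c \<odot> \<one>)) \<otimes>\<^bsub>Q\<^esub> (J +> b i) \<oplus>\<^bsub>Q\<^esub> (J +> w)"
        using c x w bi by (simp add: quotient_mult quotient_add smult_mult_left)
      ultimately show "y \<in> Q.line_extension (scalars K Q) (J +> b i) (E F)"
        using c unfolding ext by blast
    qed
    ultimately show ?case using insert by simp
  qed
  from this[OF I] show ?thesis by (simp add: has_dim_def E_def)
qed

lemma central_mod_add:
  assumes "y \<in> carrier A" "z \<in> carrier A" "x \<in> carrier A"
    "y \<otimes> x \<ominus> x \<otimes> y \<in> J" "z \<otimes> x \<ominus> x \<otimes> z \<in> J"
  shows "(y \<oplus> z) \<otimes> x \<ominus> x \<otimes> (y \<oplus> z) \<in> J"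
proof -
  have "(y \<oplus> z) \<otimes> x \<ominus> x \<otimes> (y \<oplus> z) = (y \<otimes> x \<ominus> x \<otimes> y) \<oplus> (z \<otimes> x \<ominus> x \<otimes> z)"
    using assms(1-3) by (simp add: l_distr r_distr a_minus_def minus_add a_ac)
  then show ?thesis using assms(4,5) by simp
qed

lemma central_mod_smult:
  assumes "c \<in> carrier K" "z \<in> carrier A" "x \<in> carrier A" "z \<otimes> x \<ominus> x \<otimes> z \<in> J"
  shows "(c \<odot> z) \<otimes> x \<ominus> x \<otimes> (c \<odot> z) \<in> J"
proof -
  have "c \<odot> (\<ominus> y) = \<ominus> (c \<odot> y)" if "y \<in> carrier A" for y
    using that assms(1) smult_eq[of c "\<ominus> y"] smult_eq[of c y] by (simp add: r_minus)
  then have "(c \<odot> z) \<otimes> x \<ominus> x \<otimes> (c \<odot> z) = c \<odot> (z \<otimes> x \<ominus> x \<otimes> z)"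
    using assms(1-3) by (simp add: smult_mult_left smult_mult_right a_minus_def smult_add_right)
  then show ?thesis using assms smult_mem by simp
qed

lemma has_dim_center_by_coordinates:
  fixes \<phi> :: "'i \<Rightarrow> 'b \<Rightarrow> 'k"
  defines "M \<equiv> {z \<in> carrier A. \<forall>x\<in>carrier A. z \<otimes> x \<ominus> x \<otimes> z \<in> J}"
  assumes "\<one>\<^bsub>K\<^esub> \<noteq> \<zero>\<^bsub>K\<^esub>" and "finite I" and "\<And>i. i \<in> I \<Longrightarrow> b i \<in> M"
    and "\<And>i x. \<lbrakk>i \<in> I; x \<in> carrier A\<rbrakk> \<Longrightarrow> \<phi> i x \<in> carrier K"
    and "\<And>i x y. \<lbrakk>i \<in> I; x \<in> carrier A; y \<in> carrier A\<rbrakk> \<Longrightarrow> \<phi> i (x \<oplus> y) = \<phi> i x \<oplus>\<^bsub>K\<^esub> \<phi> i y"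
    and "\<And>i c x. \<lbrakk>i \<in> I; c \<in> carrier K; x \<in> carrier A\<rbrakk> \<Longrightarrow> \<phi> i (c \<odot> x) = c \<otimes>\<^bsub>K\<^esub> \<phi> i x"
    and "\<And>i j. \<lbrakk>i \<in> I; j \<in> I\<rbrakk> \<Longrightarrow> \<phi> i (b j) = (if i = j then \<one>\<^bsub>K\<^esub> else \<zero>\<^bsub>K\<^esub>)"
    and "\<And>x. x \<in> M \<Longrightarrow> x \<in> J \<longleftrightarrow> (\<forall>i\<in>I. \<phi> i x = \<zero>\<^bsub>K\<^esub>)"
  shows "has_dim K Q (algebra_center Q) (card I)"
proof -
  have "has_dim K Q ((+>) J ` M) (card I)"
  proof (rule has_dim_by_coordinates[where b = b and \<phi> = \<phi>])
    show "M \<subseteq> carrier A" by (auto simp: M_def)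
    \<comment> \<open>A commutator with an element of the two-sided ideal \<open>J\<close> stays in
      \<open>J\<close>.\<close>
    show "J \<subseteq> M"
      using I_l_closed I_r_closed a_subset by (auto simp: M_def a_minus_def)
    show "x \<oplus> y \<in> M" if "x \<in> M" "y \<in> M" for x y
      using that central_mod_add by (auto simp: M_def)
    show "c \<odot> x \<in> M" if "c \<in> carrier K" "x \<in> M" for c x
      using that central_mod_smult by (auto simp: M_def)
  qed (fact assms)+
  then show ?thesis by (simp add: algebra_center_quotient M_def)
qed

end

section \<open>The path algebra\<close>

text \<open>Both sides run over the pairs with \<open>i + j \<le> n\<close>, once by diagonals and
  once by rows; passing to \<open>Suc n\<close> adds one diagonal. This reorders the cuts of a path
  into three pieces in the proof of associativity.\<close>

lemma (in abelian_monoid) finsum_triangle: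
  assumes "\<And>i j. i + j \<le> n \<Longrightarrow> F i j \<in> carrier G"
  shows "(\<Oplus>k\<in>{..n::nat}. \<Oplus>i\<in>{..k}. F i (k - i)) = (\<Oplus>i\<in>{..n}. \<Oplus>j\<in>{..n - i}. F i j)"
  using assms
proof (induction n)
  case 0
  then show ?case by simp
next
  case (Suc n)
  have F: "F i j \<in> carrier G" if "i + j \<le> Suc n" for i j using Suc.prems that by simp
  have "(\<Oplus>i\<in>{..Suc n}. \<Oplus>j\<in>{..Suc n - i}. F i j)
      = F (Suc n) 0 \<oplus> (\<Oplus>i\<in>{..n}. \<Oplus>j\<in>{..Suc n - i}. F i j)"
    by (subst finsum_Suc) (auto intro!: finsum_closed simp: F)
  also have "(\<Oplus>i\<in>{..n}. \<Oplus>j\<in>{..Suc n - i}. F i j)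
      = (\<Oplus>i\<in>{..n}. F i (Suc n - i) \<oplus> (\<Oplus>j\<in>{..n - i}. F i j))"
  proof (rule finsum_cong')
    fix i assume i: "i \<in> {..n}"
    then have "Suc n - i = Suc (n - i)" by auto
    then show "(\<Oplus>j\<in>{..Suc n - i}. F i j) = F i (Suc n - i) \<oplus> (\<Oplus>j\<in>{..n - i}. F i j)"
      using i by (simp only: ) (subst finsum_Suc, auto intro!: F)
  qed (auto intro!: finsum_closed F)
  also have "\<dots> = (\<Oplus>i\<in>{..n}. F i (Suc n - i)) \<oplus> (\<Oplus>i\<in>{..n}. \<Oplus>j\<in>{..n - i}. F i j)"
    by (rule finsum_addf) (auto intro!: finsum_closed F)
  also have "(\<Oplus>i\<in>{..n}. \<Oplus>j\<in>{..n - i}. F i j) = (\<Oplus>k\<in>{..n}. \<Oplus>i\<in>{..k}. F i (k - i))"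
    using Suc by simp
  also have "F (Suc n) 0 \<oplus> ((\<Oplus>i\<in>{..n}. F i (Suc n - i)) \<oplus> (\<Oplus>k\<in>{..n}. \<Oplus>i\<in>{..k}. F i (k - i)))
      = (\<Oplus>i\<in>{..Suc n}. F i (Suc n - i)) \<oplus> (\<Oplus>k\<in>{..n}. \<Oplus>i\<in>{..k}. F i (k - i))"
    by (subst finsum_Suc) (auto intro!: a_assoc[symmetric] finsum_closed simp: F)
  also have "\<dots> = (\<Oplus>k\<in>{..Suc n}. \<Oplus>i\<in>{..k}. F i (k - i))"
    by (subst (2) finsum_Suc) (auto intro!: finsum_closed simp: F)
  finally show ?case by simp
qed

lemma (in abelian_monoid) finsum_eq_single:
  assumes "finite I" "i \<in> I" "f i \<in> carrier G" "\<And>j. \<lbrakk>j \<in> I; j \<noteq> i\<rbrakk> \<Longrightarrow> f j = \<zero>"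
  shows "(\<Oplus>j\<in>I. f j) = f i"
proof -
  have f: "f \<in> I \<rightarrow> carrier G" using assms by (metis Pi_I zero_closed)
  have "(\<Oplus>j\<in>I. f j) = (\<Oplus>j\<in>I. if i = j then f j else \<zero>)"
    using assms f by (intro finsum_cong') auto
  also have "\<dots> = f i" by (rule finsum_singleton) (use assms f in auto)
  finally show ?thesis .
qed

section \<open>Concatenating and cutting paths\<close>

lemma (in wf_digraph) awlast_append: "awlast u (p @ q) = awlast (awlast u p) q"
  by (auto simp: awalk_verts_conv)

lemma (in wf_digraph) quiver_paths_iff: "(u, p) \<in> quiver_paths G \<longleftrightarrow> awalk u p (awlast u p)"
  by (auto simp: quiver_paths_def)

lemma (in wf_digraph) quiver_paths_append:
  "(u, p @ q) \<in> quiver_paths G \<longleftrightarrow> (u, p) \<in> quiver_paths G \<and> (awlast u p, q) \<in> quiver_paths G"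
  by (simp add: quiver_paths_iff awalk_append_iff awlast_append)

lemma (in wf_digraph) quiver_paths_take:
  "(u, p) \<in> quiver_paths G \<Longrightarrow> (u, take i p) \<in> quiver_paths G"
  using quiver_paths_append[of u "take i p" "drop i p"] by simp

lemma (in wf_digraph) quiver_paths_drop:
  "(u, p) \<in> quiver_paths G \<Longrightarrow> (awlast u (take i p), drop i p) \<in> quiver_paths G"
  using quiver_paths_append[of u "take i p" "drop i p"] by simp

locale quiver_path_algebra = cring K + wf_digraph Q
  for K :: "('k, 'l) ring_scheme" (structure) and Q :: "('v, 'e) pre_digraph"
begin

abbreviation PA where "PA \<equiv> path_algebra K Q"

lemma PA_carrier:
  "f \<in> carrier PA \<longleftrightarrow>
    (\<forall>p. f p \<in> carrier K) \<and> finite {p. f p \<noteq> \<zero>} \<and> (\<forall>p. f p \<noteq> \<zero> \<longrightarrow> p \<in> quiver_paths Q)"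
  by (auto simp: path_algebra_def)

lemma PA_coeff_closed [simp]: "f \<in> carrier PA \<Longrightarrow> f p \<in> carrier K"
  using PA_carrier by blast

lemma PA_coeff_zero: "\<lbrakk>f \<in> carrier PA; p \<notin> quiver_paths Q\<rbrakk> \<Longrightarrow> f p = \<zero>"
  using PA_carrier by blast

lemma PA_finite: "f \<in> carrier PA \<Longrightarrow> finite {p. f p \<noteq> \<zero>}"
  using PA_carrier by blast

lemma PA_carrierI:
  "\<lbrakk>\<And>p. f p \<in> carrier K; finite {p. f p \<noteq> \<zero>}; \<And>p. p \<notin> quiver_paths Q \<Longrightarrow> f p = \<zero>\<rbrakk>
    \<Longrightarrow> f \<in> carrier PA"
  using PA_carrier by blast

lemma PA_add: "(f \<oplus>\<^bsub>PA\<^esub> g) p = f p \<oplus> g p"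
  and PA_zero: "\<zero>\<^bsub>PA\<^esub> p = \<zero>"
  and PA_smult: "(c \<odot>\<^bsub>PA\<^esub> f) p = c \<otimes> f p"
  and PA_one: "\<one>\<^bsub>PA\<^esub> (u, q) = (if u \<in> verts Q \<and> q = [] then \<one> else \<zero>)"
  and PA_mult: "(f \<otimes>\<^bsub>PA\<^esub> g) (u, q)
      = (\<Oplus>i\<in>{..length q}. f (u, take i q) \<otimes> g (awlast u (take i q), drop i q))"
  by (simp_all add: path_algebra_def)

lemma PA_mult_nonzero:
  assumes "f \<in> carrier PA" "g \<in> carrier PA" "(f \<otimes>\<^bsub>PA\<^esub> g) (u, q) \<noteq> \<zero>"
  obtains p p' where "q = p @ p'" "f (u, p) \<noteq> \<zero>" "g (awlast u p, p') \<noteq> \<zero>"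
proof -
  have "\<exists>i\<in>{..length q}. f (u, take i q) \<otimes> g (awlast u (take i q), drop i q) \<noteq> \<zero>"
    using assms(3) unfolding PA_mult by (metis (no_types, lifting) add.finprod_one_eqI)
  then obtain i where "f (u, take i q) \<otimes> g (awlast u (take i q), drop i q) \<noteq> \<zero>" by blast
  then have "f (u, take i q) \<noteq> \<zero>" "g (awlast u (take i q), drop i q) \<noteq> \<zero>"
    using assms by auto
  then show thesis using that[of "take i q" "drop i q"] by simp
qed

lemma PA_add_closed:
  assumes "f \<in> carrier PA" "g \<in> carrier PA"
  shows "f \<oplus>\<^bsub>PA\<^esub> g \<in> carrier PA"
proof (rule PA_carrierI)
  have "{p. (f \<oplus>\<^bsub>PA\<^esub> g) p \<noteq> \<zero>} \<subseteq> {p. f p \<noteq> \<zero>} \<union> {p. g p \<noteq> \<zero>}"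
    using assms by (auto simp only: PA_add l_zero zero_closed)
  then show "finite {p. (f \<oplus>\<^bsub>PA\<^esub> g) p \<noteq> \<zero>}"
    by (rule finite_subset) (simp add: assms PA_finite)
qed (use assms in \<open>simp_all add: PA_add PA_coeff_zero\<close>)

lemma PA_smult_closed:
  assumes "c \<in> carrier K" "f \<in> carrier PA"
  shows "c \<odot>\<^bsub>PA\<^esub> f \<in> carrier PA"
proof (rule PA_carrierI)
  have "{p. (c \<odot>\<^bsub>PA\<^esub> f) p \<noteq> \<zero>} \<subseteq> {p. f p \<noteq> \<zero>}"
    using assms by (auto simp only: PA_smult r_null)
  then show "finite {p. (c \<odot>\<^bsub>PA\<^esub> f) p \<noteq> \<zero>}"
    by (rule finite_subset) (simp add: assms PA_finite)
qed (use assms in \<open>simp_all add: PA_smult PA_coeff_zero\<close>)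

lemma PA_mult_closed:
  assumes f: "f \<in> carrier PA" and g: "g \<in> carrier PA"
  shows "f \<otimes>\<^bsub>PA\<^esub> g \<in> carrier PA"
proof (rule PA_carrierI)
  let ?h = "f \<otimes>\<^bsub>PA\<^esub> g" and ?cat = "\<lambda>((u, p), (v, q)). (u, p @ q)"
  \<comment> \<open>Every path in the support of the product concatenates a path from each support.
    \<open>?cat\<close> also joins pairs that do not meet, which only enlarges the finite covering
    set.\<close>
  have "x \<in> ?cat ` ({x. f x \<noteq> \<zero>} \<times> {x. g x \<noteq> \<zero>})" if h: "?h x \<noteq> \<zero>" for x
  proof -
    obtain u q where x: "x = (u, q)" by fastforce
    then obtain p p' where "q = p @ p'" "f (u, p) \<noteq> \<zero>" "g (awlast u p, p') \<noteq> \<zero>"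
      using PA_mult_nonzero[OF f g h[unfolded x]] by metis
    then show ?thesis using x by (intro image_eqI[of _ _ "((u, p), (awlast u p, p'))"]) auto
  qed
  then have "{x. ?h x \<noteq> \<zero>} \<subseteq> ?cat ` ({x. f x \<noteq> \<zero>} \<times> {x. g x \<noteq> \<zero>})" by blast
  moreover have "finite ({x. f x \<noteq> \<zero>} \<times> {x. g x \<noteq> \<zero>})" using f g by (simp add: PA_finite)
  ultimately show "finite {x. ?h x \<noteq> \<zero>}" by (rule finite_surj[rotated])
  show "?h x = \<zero>" if "x \<notin> quiver_paths Q" for x
  proof (rule ccontr)
    assume h: "?h x \<noteq> \<zero>"
    obtain u q where x: "x = (u, q)" by fastforce
    then obtain p p' where "q = p @ p'" "f (u, p) \<noteq> \<zero>" "g (awlast u p, p') \<noteq> \<zero>"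
      using PA_mult_nonzero[OF f g h[unfolded x]] by metis
    then show False using that x PA_coeff_zero[OF f] PA_coeff_zero[OF g] quiver_paths_append by metis
  qed
  show "?h x \<in> carrier K" for x
    using f g by (cases x) (auto simp: PA_mult intro!: finsum_closed)
qed

lemma PA_one_closed:
  assumes "finite (verts Q)"
  shows "\<one>\<^bsub>PA\<^esub> \<in> carrier PA"
proof (rule PA_carrierI)
  have "{p. \<one>\<^bsub>PA\<^esub> p \<noteq> \<zero>} \<subseteq> (\<lambda>v. (v, [])) ` verts Q"
    by (auto simp: PA_one image_iff split: if_splits)
  then show "finite {p. \<one>\<^bsub>PA\<^esub> p \<noteq> \<zero>}" using assms finite_surj by blast
  show "\<one>\<^bsub>PA\<^esub> x \<in> carrier K" for x by (cases x) (simp add: PA_one)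
  show "\<one>\<^bsub>PA\<^esub> x = \<zero>" if "x \<notin> quiver_paths Q" for x
    using that by (cases x) (auto simp: PA_one quiver_paths_iff awalk_Nil_iff)
qed

lemma PA_mult_assoc:
  assumes f: "f \<in> carrier PA" and g: "g \<in> carrier PA" and h: "h \<in> carrier PA"
  shows "(f \<otimes>\<^bsub>PA\<^esub> g) \<otimes>\<^bsub>PA\<^esub> h = f \<otimes>\<^bsub>PA\<^esub> (g \<otimes>\<^bsub>PA\<^esub> h)"
proof
  fix x :: "'v \<times> 'e list" obtain u q where x: "x = (u, q)" by fastforce
  \<comment> \<open>\<open>i\<close> and \<open>j\<close> are the lengths of the first and second
    piece of \<open>q\<close>; the third piece is the rest.\<close>
  define F where "F i j = f (u, take i q) \<otimes> g (awlast u (take i q), take j (drop i q))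
     \<otimes> h (awlast u (take (i + j) q), drop (j + i) q)" for i j
  have "((f \<otimes>\<^bsub>PA\<^esub> g) \<otimes>\<^bsub>PA\<^esub> h) (u, q) = (\<Oplus>k\<in>{..length q}. \<Oplus>i\<in>{..k}. F i (k - i))"
    unfolding PA_mult
  proof (rule finsum_cong')
    fix k assume k: "k \<in> {..length q}"
    have "(\<Oplus>i\<in>{..length (take k q)}. f (u, take i (take k q))
          \<otimes> g (awlast u (take i (take k q)), drop i (take k q))) \<otimes> h (awlast u (take k q), drop k q)
        = (\<Oplus>i\<in>{..k}. f (u, take i (take k q))
          \<otimes> g (awlast u (take i (take k q)), drop i (take k q)) \<otimes> h (awlast u (take k q), drop k q))"
      using k f g h by (subst finsum_ldistr) (auto simp: min_def)
    also have "\<dots> = (\<Oplus>i\<in>{..k}. F i (k - i))"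
      using k f g h by (intro finsum_cong') (auto simp: F_def min_def drop_take)
    finally show "(\<Oplus>i\<in>{..length (take k q)}. f (u, take i (take k q))
          \<otimes> g (awlast u (take i (take k q)), drop i (take k q))) \<otimes> h (awlast u (take k q), drop k q)
        = (\<Oplus>i\<in>{..k}. F i (k - i))" .
  qed (auto simp: F_def f g h intro!: finsum_closed)
  also have "\<dots> = (\<Oplus>i\<in>{..length q}. \<Oplus>j\<in>{..length q - i}. F i j)"
    by (rule finsum_triangle) (auto simp: F_def f g h)
  also have "\<dots> = (f \<otimes>\<^bsub>PA\<^esub> (g \<otimes>\<^bsub>PA\<^esub> h)) (u, q)"
    unfolding PA_mult
  proof (rule finsum_cong')
    fix i assume i: "i \<in> {..length q}"
    show "(\<Oplus>j\<in>{..length q - i}. F i j) = f (u, take i q) \<otimes> (\<Oplus>j\<in>{..length (drop i q)}.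
      g (awlast u (take i q), take j (drop i q)) \<otimes>
      h (awlast (awlast u (take i q)) (take j (drop i q)), drop j (drop i q)))"
      using f g h
      by (subst finsum_rdistr)
        (auto simp: F_def m_assoc take_add awlast_append intro!: finsum_cong')
  qed (auto simp: f g h intro!: finsum_closed)
  finally show "((f \<otimes>\<^bsub>PA\<^esub> g) \<otimes>\<^bsub>PA\<^esub> h) x = (f \<otimes>\<^bsub>PA\<^esub> (g \<otimes>\<^bsub>PA\<^esub> h)) x" by (simp add: x)
qed

text \<open>This and its mirror image below evaluate most coefficients of products computed later:
  they apply when only one of the two extreme cuts can contribute.\<close>

lemma PA_mult_eq_last:
  assumes "f \<in> carrier PA" "g \<in> carrier PA" "\<And>i. i < length q \<Longrightarrow> f (u, take i q) \<otimes> g (awlast u (take i q), drop i q) = \<zero>"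
  shows "(f \<otimes>\<^bsub>PA\<^esub> g) (u, q) = f (u, q) \<otimes> g (awlast u q, [])"
  unfolding PA_mult using assms by (subst finsum_eq_single[of _ "length q"]) auto

lemma PA_mult_eq_first:
  assumes "f \<in> carrier PA" "g \<in> carrier PA"
    "\<And>i. \<lbrakk>0 < i; i \<le> length q\<rbrakk> \<Longrightarrow> f (u, take i q) \<otimes> g (awlast u (take i q), drop i q) = \<zero>"
  shows "(f \<otimes>\<^bsub>PA\<^esub> g) (u, q) = f (u, []) \<otimes> g (u, q)"
  unfolding PA_mult using assms by (subst finsum_eq_single[of _ 0]) auto

text \<open>The unit is the sum of the trivial paths; finitely many vertices give it finite
  support.\<close>

lemma assoc_algebra:
  assumes fin: "finite (verts Q)"
  shows "assoc_algebra K PA"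
proof -
  have neg: "\<exists>y\<in>carrier PA. y \<oplus>\<^bsub>PA\<^esub> f = \<zero>\<^bsub>PA\<^esub>" if f: "f \<in> carrier PA" for f
    using PA_smult_closed[of "\<ominus> \<one>" f] f
    by (intro bexI[of _ "(\<ominus> \<one>) \<odot>\<^bsub>PA\<^esub> f"]) (auto simp: PA_add PA_smult PA_zero l_minus l_neg)
  have one: "\<one>\<^bsub>PA\<^esub> \<otimes>\<^bsub>PA\<^esub> f = f" "f \<otimes>\<^bsub>PA\<^esub> \<one>\<^bsub>PA\<^esub> = f" if f: "f \<in> carrier PA" for f
  proof -
    have "(\<one>\<^bsub>PA\<^esub> \<otimes>\<^bsub>PA\<^esub> f) (u, q) = f (u, q)" for u q
    proof -
      have "f (u, q) = \<zero>" if "u \<notin> verts Q"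
        using that f by (intro PA_coeff_zero) (auto simp: quiver_paths_iff awalk_def)
      then show ?thesis using f PA_one_closed[OF fin] by (subst PA_mult_eq_first) (auto simp: PA_one)
    qed
    moreover have "(f \<otimes>\<^bsub>PA\<^esub> \<one>\<^bsub>PA\<^esub>) (u, q) = f (u, q)" for u q
    proof -
      have "f (u, q) = \<zero>" if "awlast u q \<notin> verts Q"
        using that f by (intro PA_coeff_zero) (auto simp: quiver_paths_iff dest: awalk_last_in_verts)
      then show ?thesis using f PA_one_closed[OF fin] by (subst PA_mult_eq_last) (auto simp: PA_one)
    qed
    ultimately show "\<one>\<^bsub>PA\<^esub> \<otimes>\<^bsub>PA\<^esub> f = f" "f \<otimes>\<^bsub>PA\<^esub> \<one>\<^bsub>PA\<^esub> = f" by auto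
  qed
  have distr: "(f \<oplus>\<^bsub>PA\<^esub> g) \<otimes>\<^bsub>PA\<^esub> h = f \<otimes>\<^bsub>PA\<^esub> h \<oplus>\<^bsub>PA\<^esub> g \<otimes>\<^bsub>PA\<^esub> h"
      "h \<otimes>\<^bsub>PA\<^esub> (f \<oplus>\<^bsub>PA\<^esub> g) = h \<otimes>\<^bsub>PA\<^esub> f \<oplus>\<^bsub>PA\<^esub> h \<otimes>\<^bsub>PA\<^esub> g"
    if "f \<in> carrier PA" "g \<in> carrier PA" "h \<in> carrier PA" for f g h
    using that by (auto simp: fun_eq_iff PA_mult PA_add l_distr r_distr)
  have smult: "(c \<odot>\<^bsub>PA\<^esub> f) \<otimes>\<^bsub>PA\<^esub> g = c \<odot>\<^bsub>PA\<^esub> (f \<otimes>\<^bsub>PA\<^esub> g)" "f \<otimes>\<^bsub>PA\<^esub> (c \<odot>\<^bsub>PA\<^esub> g) = c \<odot>\<^bsub>PA\<^esub> (f \<otimes>\<^bsub>PA\<^esub> g)"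
    if "c \<in> carrier K" "f \<in> carrier PA" "g \<in> carrier PA" for c f g
    using that by (auto simp: fun_eq_iff PA_mult PA_smult finsum_rdistr m_assoc m_lcomm intro!: finsum_cong')
  have "\<zero>\<^bsub>PA\<^esub> \<in> carrier PA" by (rule PA_carrierI) (simp_all add: PA_zero)
  then have "abelian_group PA"
    by (intro abelian_groupI neg) (auto simp: PA_add_closed fun_eq_iff PA_add PA_zero a_assoc a_comm a_lcomm)
  moreover have "Group.monoid PA"
    by (intro monoidI) (auto simp: PA_mult_closed PA_one_closed fin PA_mult_assoc one)
  ultimately have "ring PA" by (intro ringI) (auto simp: distr)
  then show ?thesis
    by (intro assoc_algebra.intro assoc_algebra_axioms.intro cring_axioms)
      (auto simp: PA_smult_closed smult fun_eq_iff PA_add PA_smult l_distr)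
qed

subsection \<open>Paths as elements of the path algebra\<close>

lemma path_elt_closed: "p \<in> quiver_paths Q \<Longrightarrow> path_elt K p \<in> carrier PA"
  by (rule PA_carrierI) (auto simp: path_elt_def intro: finite_subset[of _ "{p}"])

lemma path_elt_mult:
  assumes "(u, p @ q) \<in> quiver_paths Q"
  shows "path_elt K (u, p) \<otimes>\<^bsub>PA\<^esub> path_elt K (awlast u p, q) = path_elt K (u, p @ q)"
proof
  fix x :: "'v \<times> 'e list" obtain v r where x: "x = (v, r)" by fastforce
  have eq: "(\<Oplus>i\<in>{..length r}. path_elt K (u, p) (v, take i r) \<otimes>
      path_elt K (awlast u p, q) (awlast v (take i r), drop i r)) = path_elt K (u, p @ q) (v, r)"
  proof (cases "v = u \<and> r = p @ q")
    case True
    then show ?thesis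
      by (subst finsum_eq_single[of _ "length p"])
        (auto simp: path_elt_def dest: arg_cong[of _ p length])
  next
    case False
    then have "path_elt K (u, p) (v, take i r) \<otimes>
      path_elt K (awlast u p, q) (awlast v (take i r), drop i r) = \<zero>" for i
      by (auto simp: path_elt_def)
    then have "(\<Oplus>i\<in>{..length r}. path_elt K (u, p) (v, take i r) \<otimes>
      path_elt K (awlast u p, q) (awlast v (take i r), drop i r)) = \<zero>" by simp
    then show ?thesis using False by (auto simp: path_elt_def)
  qed
  show "(path_elt K (u, p) \<otimes>\<^bsub>PA\<^esub> path_elt K (awlast u p, q)) x = path_elt K (u, p @ q) x"
    unfolding x PA_mult by (rule eq)
qed

end

section \<open>Multiplicity-free configurations with a vertex common to all polygons\<close>

text \<open>Apart from the final count of subgroups, the non-prime case uses the group only through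
  these conditions; \<open>e\<close> stands for its identity element.\<close>

locale multiplicity_free_configuration = brauer_configuration \<Gamma>
  for \<Gamma> :: "('a, 'i, 'm) brauer_config_scheme" +
  fixes e :: 'a
  assumes mu_one: "\<alpha> \<in> vertices \<Gamma> \<Longrightarrow> mu \<Gamma> \<alpha> = 1"
    and count_le_one: "V \<in> polygons \<Gamma> \<Longrightarrow> count (elts \<Gamma> V) \<alpha> \<le> 1"
    and apex_vertex: "e \<in> vertices \<Gamma>"
    and apex_mem: "V \<in> polygons \<Gamma> \<Longrightarrow> e \<in># elts \<Gamma> V"
begin

abbreviation "NT \<equiv> nontruncated \<Gamma>"
abbreviation "s \<equiv> succ_seq \<Gamma>"
abbreviation "n \<equiv> val \<Gamma>"
abbreviation "Q \<equiv> brauer_quiver \<Gamma>"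

section \<open>Valencies and successor sequences\<close>

lemma val_card: "n \<alpha> = card {V \<in> polygons \<Gamma>. \<alpha> \<in># elts \<Gamma> V}"
proof -
  have "count (elts \<Gamma> V) \<alpha> = (if \<alpha> \<in># elts \<Gamma> V then 1 else 0)" if "V \<in> polygons \<Gamma>" for V
    using count_le_one[OF that, of \<alpha>] by (auto simp: count_eq_zero_iff le_Suc_eq)
  then have "n \<alpha> = (\<Sum>V\<in>polygons \<Gamma>. if \<alpha> \<in># elts \<Gamma> V then 1 else 0)"
    unfolding val_def by (intro sum.cong) auto
  then show ?thesis using finite_polygons by (simp add: sum.If_cases Int_def)
qed

text \<open>(C1) excludes valency zero, and with \<mu> = 1 valency one means truncated. Hence a
  single arrow is never a whole special cycle.\<close>

lemma val_ge_two: "\<alpha> \<in> NT \<Longrightarrow> 2 \<le> n \<alpha>"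
proof -
  assume a: "\<alpha> \<in> NT"
  then have "{V \<in> polygons \<Gamma>. \<alpha> \<in># elts \<Gamma> V} \<noteq> {}" using C1 by (auto simp: nontruncated_def)
  then have "n \<alpha> \<noteq> 0" using finite_polygons by (simp add: val_card)
  moreover have "n \<alpha> \<noteq> 1" using a mu_one by (auto simp: nontruncated_def truncated_def)
  ultimately show ?thesis by simp
qed

text \<open>The multiplicity of a polygon \<open>V\<close> in \<open>s \<alpha>\<close> is
  \<open>count (elts \<Gamma> V) \<alpha>\<close>, which is at most one.\<close>

lemma
  assumes "\<alpha> \<in> NT"
  shows distinct_succ_seq: "distinct (s \<alpha>)"
    and set_succ_seq: "set (s \<alpha>) = {V \<in> polygons \<Gamma>. \<alpha> \<in># elts \<Gamma> V}"
    and length_succ_seq: "length (s \<alpha>) = n \<alpha>"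
proof -
  have c: "count (mset (s \<alpha>)) V = (if V \<in> polygons \<Gamma> then count (elts \<Gamma> V) \<alpha> else 0)" for V
    using finite_polygons by (simp add: orientation[OF assms] count_sum)
  have "V \<in> set (s \<alpha>) \<longleftrightarrow> V \<in> polygons \<Gamma> \<and> \<alpha> \<in># elts \<Gamma> V" for V
  proof -
    have "V \<in> set (s \<alpha>) \<longleftrightarrow> count (mset (s \<alpha>)) V \<noteq> 0" by simp
    also have "\<dots> \<longleftrightarrow> V \<in> polygons \<Gamma> \<and> \<alpha> \<in># elts \<Gamma> V" by (simp only: c) simp
    finally show ?thesis .
  qed
  then show set: "set (s \<alpha>) = {V \<in> polygons \<Gamma>. \<alpha> \<in># elts \<Gamma> V}" by blast
  have "count (mset (s \<alpha>)) V \<le> 1" for V using c count_le_one by simp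
  then show "distinct (s \<alpha>)"
    unfolding distinct_count_atmost_1
    by (metis One_nat_def count_eq_zero_iff le_Suc_eq le_zero_eq set_mset_mset)
  then show "length (s \<alpha>) = n \<alpha>" using set by (metis distinct_card val_card)
qed

text \<open>(C3) provides a vertex of valency at least two, and \<open>e\<close> lies in at least as
  many polygons.\<close>

lemma apex_nontruncated: "e \<in> NT"
proof -
  obtain V where "V \<in> polygons \<Gamma>" using C1 apex_vertex by blast
  then obtain \<alpha> where \<alpha>: "\<alpha> \<in># elts \<Gamma> V" "n \<alpha> * mu \<Gamma> \<alpha> > 1" "\<alpha> \<in> vertices \<Gamma>"
    using C3 elts_vertices by blast
  have "n \<alpha> \<le> n e" unfolding val_card using finite_polygons apex_mem by (intro card_mono) auto
  then show ?thesis using \<alpha> mu_one[OF \<alpha>(3)] apex_vertex by (simp add: nontruncated_def truncated_def)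
qed

lemma set_succ_seq_apex: "set (s e) = polygons \<Gamma>"
  using set_succ_seq[OF apex_nontruncated] apex_mem by auto

lemma quiver_simps [simp]:
  "verts Q = polygons \<Gamma>"
  "(\<alpha>, j) \<in> arcs Q \<longleftrightarrow> \<alpha> \<in> NT \<and> j < n \<alpha>"
  "tail Q (\<alpha>, j) = s \<alpha> ! j"
  "head Q (\<alpha>, j) = s \<alpha> ! (Suc j mod n \<alpha>)"
  by (simp_all add: brauer_quiver_def)

lemma succ_seq_in_polygons: "\<lbrakk>\<alpha> \<in> NT; j < n \<alpha>\<rbrakk> \<Longrightarrow> s \<alpha> ! j \<in> polygons \<Gamma>"
  using set_succ_seq[of \<alpha>] length_succ_seq[of \<alpha>] nth_mem[of j "s \<alpha>"] by auto

sublocale wf_digraph Q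
proof
  show "tail Q a \<in> verts Q" if "a \<in> arcs Q" for a
    using that by (cases a) (simp add: succ_seq_in_polygons)
  show "head Q a \<in> verts Q" if "a \<in> arcs Q" for a
    using that by (cases a) (simp add: succ_seq_in_polygons)
qed

text \<open>A run of \<open>k\<close> consecutive arrows at \<open>\<alpha>\<close> from position
  \<open>l\<close>, going round as often as \<open>k\<close> demands: \<open>k < n \<alpha>\<close>
  gives the proper pieces of special cycles, \<open>k = n \<alpha>\<close> the special cycles,
  \<open>k = n \<alpha> + 1\<close> the relations of type two.\<close>

definition track :: "'a \<Rightarrow> nat \<Rightarrow> nat \<Rightarrow> ('a \<times> nat) list" where
  "track \<alpha> l k = map (\<lambda>j. (\<alpha>, (l + j) mod n \<alpha>)) [0..<k]"

lemma length_track [simp]: "length (track \<alpha> l k) = k"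
  by (simp add: track_def)

lemma track_0 [simp]: "track \<alpha> l 0 = []"
  by (simp add: track_def)

lemma nth_track [simp]: "i < k \<Longrightarrow> track \<alpha> l k ! i = (\<alpha>, (l + i) mod n \<alpha>)"
  by (simp add: track_def)

lemma take_track: "i \<le> k \<Longrightarrow> take i (track \<alpha> l k) = track \<alpha> l i"
  by (rule nth_equalityI) auto

lemma drop_track: "drop i (track \<alpha> l k) = track \<alpha> ((l + i) mod n \<alpha>) (k - i)"
  by (rule nth_equalityI) (auto simp: mod_add_left_eq add.assoc)

lemma track_Suc: "l < n \<alpha> \<Longrightarrow> track \<alpha> l (Suc k) = (\<alpha>, l) # track \<alpha> (Suc l mod n \<alpha>) k"
  by (rule nth_equalityI) (auto simp: nth_Cons mod_add_left_eq mod_Suc_eq split: nat.splits)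

lemma track_snoc: "track \<alpha> l (Suc k) = track \<alpha> l k @ [(\<alpha>, (l + k) mod n \<alpha>)]"
  by (simp add: track_def)

text \<open>The first arrow reveals \<open>\<alpha>\<close> and \<open>l\<close>, whereas all tracks
  of length zero coincide.\<close>

lemma track_eq_iff:
  assumes "track \<alpha> l k = track \<beta> l' k'" "k > 0" "l < n \<alpha>" "l' < n \<beta>"
  shows "\<alpha> = \<beta> \<and> l = l' \<and> k = k'"
proof -
  have k: "k = k'" using assms(1) length_track by metis
  have "track \<alpha> l k ! 0 = track \<beta> l' k' ! 0" using assms(1) by simp
  then show ?thesis using assms k by simp
qed

lemma awalk_track:
  assumes "\<alpha> \<in> NT" "l < n \<alpha>"
  shows "awalk (s \<alpha> ! l) (track \<alpha> l k) (s \<alpha> ! ((l + k) mod n \<alpha>))"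
proof (induction k)
  case 0
  then show ?case using assms by (simp add: awalk_Nil_iff succ_seq_in_polygons)
next
  case (Suc k)
  let ?v = "s \<alpha> ! ((l + k) mod n \<alpha>)"
  have "awalk ?v [(\<alpha>, (l + k) mod n \<alpha>)] (s \<alpha> ! (Suc (l + k) mod n \<alpha>))"
    using assms by (auto simp: awalk_def succ_seq_in_polygons mod_Suc_eq)
  with Suc show ?case unfolding track_snoc by (auto intro: awalk_appendI)
qed

lemma special_cycle_eq:
  assumes "l < n \<alpha>" shows "special_cycle \<Gamma> \<alpha> l = (s \<alpha> ! l, track \<alpha> l (n \<alpha>))"
proof -
  have "rotate l (map (Pair \<alpha>) [0..<n \<alpha>]) = track \<alpha> l (n \<alpha>)"
    using assms by (intro nth_equalityI) (auto simp: nth_rotate add.commute)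
  then show ?thesis by (simp add: special_cycle_def)
qed

text \<open>Trivial paths are the case \<open>k = 0\<close>, at any polygon. For
  \<open>k > 0\<close>, being a path forces \<open>u\<close> to be
  \<open>s \<alpha> ! l\<close>.\<close>

definition short :: "('i \<times> ('a \<times> nat) list) set" where
  "short = {(u, p) \<in> quiver_paths Q. \<exists>\<alpha>\<in>NT. \<exists>l<n \<alpha>. \<exists>k<n \<alpha>. p = track \<alpha> l k}"

definition cycles_at :: "'i \<Rightarrow> ('i \<times> ('a \<times> nat) list) set" where
  "cycles_at V = {C. fst C = V \<and> (\<exists>\<alpha>. (\<alpha>, C) \<in> special_cycles \<Gamma>)}"

lemma special_cycles_iff:
  "(\<alpha>, C) \<in> special_cycles \<Gamma> \<longleftrightarrow> \<alpha> \<in> NT \<and> (\<exists>l<n \<alpha>. C = (s \<alpha> ! l, track \<alpha> l (n \<alpha>)))"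
  by (auto simp: special_cycles_def) (metis special_cycle_eq)+

lemma cycles_atE:
  assumes "C \<in> cycles_at V"
  obtains \<alpha> l where "\<alpha> \<in> NT" "l < n \<alpha>" "V = s \<alpha> ! l" "C = (V, track \<alpha> l (n \<alpha>))"
  using assms by (auto simp: cycles_at_def special_cycles_iff)

lemma shortE:
  assumes "(u, p) \<in> short"
  obtains \<alpha> l k where "\<alpha> \<in> NT" "l < n \<alpha>" "k < n \<alpha>" "p = track \<alpha> l k" "(u, p) \<in> quiver_paths Q"
  using assms by (auto simp: short_def)

lemma shortI:
  "\<lbrakk>(u, track \<alpha> l k) \<in> quiver_paths Q; \<alpha> \<in> NT; l < n \<alpha>; k < n \<alpha>\<rbrakk> \<Longrightarrow> (u, track \<alpha> l k) \<in> short"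
  by (auto simp: short_def)

lemma finite_cycles_at: "finite (cycles_at V)"
proof -
  have "NT \<subseteq> vertices \<Gamma>" by (auto simp: nontruncated_def)
  then have "finite NT" using finite_vertices finite_subset by blast
  then have "finite (Sigma NT (\<lambda>\<alpha>. {..<n \<alpha>}))" by simp
  moreover have "cycles_at V \<subseteq> (\<lambda>(\<alpha>, l). (s \<alpha> ! l, track \<alpha> l (n \<alpha>))) ` (Sigma NT (\<lambda>\<alpha>. {..<n \<alpha>}))"
    by (force elim: cycles_atE)
  ultimately show ?thesis by (rule finite_surj)
qed

lemma cycle_path:
  assumes "(V, c) \<in> cycles_at V"
  shows "(V, c) \<in> quiver_paths Q" "awlast V c = V"
proof -
  obtain \<alpha> l where c: "\<alpha> \<in> NT" "l < n \<alpha>" "V = s \<alpha> ! l" "c = track \<alpha> l (n \<alpha>)"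
    using assms by (auto elim: cycles_atE)
  then have "awalk V c V" using awalk_track[of \<alpha> l "n \<alpha>"] by simp
  then show "(V, c) \<in> quiver_paths Q" "awlast V c = V" by (auto simp: quiver_paths_def)
qed

lemma cycle_not_short: "C \<in> cycles_at V \<Longrightarrow> C \<notin> short"
  using track_eq_iff val_ge_two by (elim cycles_atE) (auto elim!: shortE, fastforce)

text \<open>Closure of \<open>short\<close> under initial and, below, final pieces makes the
  elements vanishing on it a two-sided ideal.\<close>

lemma short_take:
  assumes "(u, p) \<in> short" shows "(u, take i p) \<in> short"
proof (cases "i \<le> length p")
  case True
  then show ?thesis
    using assms quiver_paths_take[of u p i] by (elim shortE) (auto simp: take_track intro!: shortI)
qed (use assms in simp)

lemma short_drop:
  assumes "(u, p) \<in> short" shows "(awlast u (take i p), drop i p) \<in> short"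
  using assms
proof (rule shortE)
  fix \<alpha> l k
  assume *: "\<alpha> \<in> NT" "l < n \<alpha>" "k < n \<alpha>" "p = track \<alpha> l k" "(u, p) \<in> quiver_paths Q"
  show ?thesis
    using * quiver_paths_drop[OF *(5), of i] unfolding *(4) drop_track by (intro shortI) auto
qed

text \<open>Dropping even one arrow leaves fewer than \<open>n \<alpha>\<close>. So a factor that
  vanishes on short paths can contribute at a special cycle only when it receives the whole
  cycle.\<close>

lemma cycle_take_short:
  assumes "(V, c) \<in> cycles_at V" "i < length c" shows "(V, take i c) \<in> short"
  using assms quiver_paths_take[OF cycle_path(1)[OF assms(1)], of i]
  by (elim cycles_atE) (auto simp: take_track intro!: shortI)

lemma cycle_drop_short:
  assumes "(V, c) \<in> cycles_at V" "0 < i" shows "(awlast V (take i c), drop i c) \<in> short"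
  using assms(1)
proof (rule cycles_atE)
  fix \<alpha> l
  assume *: "\<alpha> \<in> NT" "l < n \<alpha>" "V = s \<alpha> ! l" "(V, c) = (V, track \<alpha> l (n \<alpha>))"
  have c: "c = track \<alpha> l (n \<alpha>)" using *(4) by simp
  show ?thesis
    using * assms(2) quiver_paths_drop[OF cycle_path(1)[OF assms(1)], of i]
    unfolding c drop_track by (intro shortI) auto
qed

lemma trivial_short: "u \<in> polygons \<Gamma> \<Longrightarrow> (u, []) \<in> short"
  using apex_nontruncated val_ge_two[of e]
  by (auto simp: short_def quiver_paths_iff awalk_Nil_iff intro!: bexI[of _ e] exI[of _ 0])

text \<open>One arrow is a track of length \<open>1 < n \<alpha>\<close>, because valencies of
  nontruncated vertices are at least two.\<close>

lemma arc_short: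
  assumes "(u, [a]) \<in> quiver_paths Q" shows "(u, [a]) \<in> short"
proof -
  obtain \<alpha> j where a: "a = (\<alpha>, j)" by fastforce
  have "\<alpha> \<in> NT" "j < n \<alpha>" using assms by (auto simp: a quiver_paths_iff awalk_def)
  moreover have "[a] = track \<alpha> j 1" using \<open>j < n \<alpha>\<close> by (simp add: a track_def)
  ultimately show ?thesis using assms val_ge_two[of \<alpha>] shortI[of u \<alpha> j 1] by auto
qed

text \<open>Fewer than \<open>n \<alpha>\<close> steps along a cyclic sequence without repetitions
  cannot lead back to the start.\<close>

lemma short_closed_trivial:
  assumes "(u, p) \<in> short" "awlast u p = u" shows "p = []"
proof (rule ccontr)
  assume p: "p \<noteq> []"
  obtain \<alpha> l k where a: "\<alpha> \<in> NT" "l < n \<alpha>" "k < n \<alpha>" "p = track \<alpha> l k" "(u, p) \<in> quiver_paths Q"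
    using assms(1) by (rule shortE)
  then obtain k' where k: "k = Suc k'" using p by (cases k) auto
  have u: "u = s \<alpha> ! l" using a k by (simp add: track_Suc quiver_paths_iff awalk_def)
  then have "awlast u p = s \<alpha> ! ((l + k) mod n \<alpha>)"
    using awlast_if_cas awalk_track[OF a(1,2)] a(4) by (auto simp: awalk_def)
  then have "(l + k) mod n \<alpha> = l"
    using u assms(2) a nth_eq_iff_index_eq[OF distinct_succ_seq] length_succ_seq by simp
  \<comment> \<open>\<open>l + k\<close> is below \<open>2 * n \<alpha>\<close>, so its residue is
    \<open>l + k\<close> or \<open>l + k - n \<alpha>\<close>; neither is \<open>l\<close> when
    \<open>0 < k < n \<alpha>\<close>.\<close>
  then show False using a k by (cases "l + k < n \<alpha>") (auto simp: mod_if split: if_splits)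
qed

lemma short_or_cycle:
  assumes "(u, track \<alpha> l k) \<in> quiver_paths Q" "\<alpha> \<in> NT" "l < n \<alpha>" "k \<le> n \<alpha>"
  shows "(u, track \<alpha> l k) \<in> short \<or> (u, track \<alpha> l k) \<in> cycles_at u"
proof (cases "k = n \<alpha>")
  case True
  moreover obtain k' where "n \<alpha> = Suc k'" using assms(3) not0_implies_Suc by fastforce
  ultimately have "track \<alpha> l k = (\<alpha>, l) # track \<alpha> (Suc l mod n \<alpha>) k'"
    using track_Suc[OF assms(3)] by metis
  then have "u = s \<alpha> ! l" using assms(1) by (simp add: quiver_paths_iff awalk_def)
  then show ?thesis using assms True by (auto simp: cycles_at_def special_cycles_iff)
qed (use assms in \<open>auto intro!: shortI\<close>)

text \<open>The representative of the special cycles at \<open>V\<close>. It exists for every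
  polygon because \<open>e\<close> lies in all of them, and is unique because \<open>s e\<close> has
  no repetitions.\<close>

definition apex_cycle :: "'i \<Rightarrow> 'i \<times> ('a \<times> nat) list" where
  "apex_cycle V = (THE C. (e, C) \<in> special_cycles \<Gamma> \<and> fst C = V)"

lemma apex_cycle_unique:
  assumes "V \<in> polygons \<Gamma>"
  shows "\<exists>!C. (e, C) \<in> special_cycles \<Gamma> \<and> fst C = V"
proof -
  obtain l where l: "l < n e" "s e ! l = V"
    using assms set_succ_seq_apex length_succ_seq[OF apex_nontruncated] by (metis in_set_conv_nth)
  have uniq: "j = l" if "j < n e" "s e ! j = V" for j
    using that l nth_eq_iff_index_eq[OF distinct_succ_seq[OF apex_nontruncated]]
      length_succ_seq[OF apex_nontruncated] by auto
  show ?thesis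
  proof (intro ex1I conjI)
    show "(e, (V, track e l (n e))) \<in> special_cycles \<Gamma>"
      using l apex_nontruncated by (auto simp: special_cycles_iff)
    fix C assume "(e, C) \<in> special_cycles \<Gamma> \<and> fst C = V"
    then obtain j where "j < n e" "C = (s e ! j, track e j (n e))" "s e ! j = V"
      by (auto simp: special_cycles_iff)
    then show "C = (V, track e l (n e))" using uniq by simp
  qed simp
qed

lemma
  assumes "V \<in> polygons \<Gamma>"
  shows apex_cycle_special: "(e, apex_cycle V) \<in> special_cycles \<Gamma>"
    and fst_apex_cycle: "fst (apex_cycle V) = V"
  using theI'[OF apex_cycle_unique[OF assms]] by (auto simp: apex_cycle_def)

lemma apex_cycle_eqI:
  "\<lbrakk>V \<in> polygons \<Gamma>; (e, C) \<in> special_cycles \<Gamma>; fst C = V\<rbrakk> \<Longrightarrow> C = apex_cycle V"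
  using apex_cycle_unique apex_cycle_special fst_apex_cycle by blast

lemma apex_cycle_at: "V \<in> polygons \<Gamma> \<Longrightarrow> apex_cycle V \<in> cycles_at V"
  using apex_cycle_special fst_apex_cycle by (auto simp: cycles_at_def)

lemma sublist_track:
  assumes "sublist [a, b] (track \<alpha> l k)"
  obtains i where "a = (\<alpha>, (l + i) mod n \<alpha>)" "b = (\<alpha>, Suc (l + i) mod n \<alpha>)"
proof -
  obtain xs ys where t: "track \<alpha> l k = xs @ [a, b] @ ys" using assms by (auto simp: sublist_def)
  then have k: "k = length xs + 2 + length ys" by (metis length_track length_append length_Cons list.size(3) numeral_2_eq_2 add.assoc)
  have "track \<alpha> l k ! length xs = a" "track \<alpha> l k ! Suc (length xs) = b"
    unfolding t by (simp_all add: nth_append)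
  then show thesis using that[of "length xs"] k by auto
qed

end

section \<open>The Brauer configuration algebra\<close>

locale multiplicity_free_algebra = field K + multiplicity_free_configuration \<Gamma> e
  for K :: "('k, 'l) ring_scheme" (structure) and \<Gamma> :: "('a, 'i, 'm) brauer_config_scheme" and e
begin

sublocale quiver_path_algebra K "brauer_quiver \<Gamma>" ..

sublocale A: assoc_algebra K "path_algebra K (brauer_quiver \<Gamma>)"
  by (rule assoc_algebra) (simp add: finite_polygons)

lemma path_elt_apply: "path_elt K p q = (if q = p then \<one> else \<zero>)"
  by (simp add: path_elt_def)

lemma PA_uminus:
  assumes "f \<in> carrier PA" shows "(\<ominus>\<^bsub>PA\<^esub> f) x = \<ominus> f x"
proof -
  have "\<ominus>\<^bsub>PA\<^esub> f = (\<ominus> \<one>) \<odot>\<^bsub>PA\<^esub> f" using assms A.smult_minus_left[of \<one> f] by simp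
  then show ?thesis using assms by (simp add: PA_smult l_minus)
qed

lemma PA_minus: "\<lbrakk>f \<in> carrier PA; g \<in> carrier PA\<rbrakk> \<Longrightarrow> (f \<ominus>\<^bsub>PA\<^esub> g) x = f x \<ominus> g x"
  by (simp add: a_minus_def PA_add PA_uminus)

text \<open>Since the quotient identifies all special cycles at \<open>V\<close>, this is the
  coordinate of their common class.\<close>

definition cycle_sum :: "'i \<Rightarrow> ('i \<times> ('a \<times> nat) list \<Rightarrow> 'k) \<Rightarrow> 'k" where
  "cycle_sum V f = (\<Oplus>C\<in>cycles_at V. f C)"

lemma cycle_sum_closed [simp]: "f \<in> carrier PA \<Longrightarrow> cycle_sum V f \<in> carrier K"
  by (simp add: cycle_sum_def Pi_def)

lemma cycle_sum_add:
  "\<lbrakk>f \<in> carrier PA; g \<in> carrier PA\<rbrakk> \<Longrightarrow> cycle_sum V (f \<oplus>\<^bsub>PA\<^esub> g) = cycle_sum V f \<oplus> cycle_sum V g"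
  by (simp add: cycle_sum_def PA_add Pi_def)

lemma cycle_sum_smult:
  "\<lbrakk>c \<in> carrier K; f \<in> carrier PA\<rbrakk> \<Longrightarrow> cycle_sum V (c \<odot>\<^bsub>PA\<^esub> f) = c \<otimes> cycle_sum V f"
  by (simp add: cycle_sum_def PA_smult finsum_rdistr finite_cycles_at Pi_def)

lemma cycle_sum_uminus: "f \<in> carrier PA \<Longrightarrow> cycle_sum V (\<ominus>\<^bsub>PA\<^esub> f) = \<ominus> cycle_sum V f"
  using A.smult_minus_left[of \<one> f] cycle_sum_smult[of "\<ominus> \<one>" f V] by (simp add: l_minus)

lemma cycle_sum_minus:
  "\<lbrakk>f \<in> carrier PA; g \<in> carrier PA\<rbrakk> \<Longrightarrow> cycle_sum V (f \<ominus>\<^bsub>PA\<^esub> g) = cycle_sum V f \<ominus> cycle_sum V g"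
  by (simp add: a_minus_def cycle_sum_add cycle_sum_uminus)

lemma cycle_sum_single:
  assumes "C \<in> cycles_at V" "f C \<in> carrier K" "\<And>D. \<lbrakk>D \<in> cycles_at V; D \<noteq> C\<rbrakk> \<Longrightarrow> f D = \<zero>"
  shows "cycle_sum V f = f C"
  unfolding cycle_sum_def using assms finite_cycles_at by (intro finsum_eq_single) auto

lemma cycle_sum_zero: "(\<And>C. C \<in> cycles_at V \<Longrightarrow> f C = \<zero>) \<Longrightarrow> cycle_sum V f = \<zero>"
  by (simp add: cycle_sum_def add.finprod_one_eqI)

subsection \<open>A linear description of the ideal of relations\<close>

text \<open>Not the Jacobson radical of the quotient, which also contains the arrows: modulo
  \<open>J\<close> this ideal is spanned by the special cycles.\<close>

definition radical :: "('i \<times> ('a \<times> nat) list \<Rightarrow> 'k) set" where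
  "radical = {f \<in> carrier PA. \<forall>x\<in>short. f x = \<zero>}"

definition J :: "('i \<times> ('a \<times> nat) list \<Rightarrow> 'k) set" where
  "J = {f \<in> radical. \<forall>V\<in>polygons \<Gamma>. cycle_sum V f = \<zero>}"

lemma radicalI: "\<lbrakk>f \<in> carrier PA; \<And>u p. (u, p) \<in> short \<Longrightarrow> f (u, p) = \<zero>\<rbrakk> \<Longrightarrow> f \<in> radical"
  by (auto simp: radical_def)

lemma radical_carrier: "f \<in> radical \<Longrightarrow> f \<in> carrier PA"
  by (simp add: radical_def)

lemma radical_zero: "\<lbrakk>f \<in> radical; x \<in> short\<rbrakk> \<Longrightarrow> f x = \<zero>"
  by (simp add: radical_def)

lemma radical_minus: "\<lbrakk>f \<in> radical; g \<in> radical\<rbrakk> \<Longrightarrow> f \<ominus>\<^bsub>PA\<^esub> g \<in> radical"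
  by (rule radicalI) (auto simp: radical_carrier PA_minus radical_zero r_right_minus_eq)

text \<open>Every cut but the last hands \<open>f\<close> a short path. At a short path the last cut
  vanishes as well; at a special cycle it reads \<open>g\<close> at the trivial path of the end
  \<open>V\<close>.\<close>

lemma
  assumes f: "f \<in> radical" and g: "g \<in> carrier PA"
  shows radical_mult_right: "f \<otimes>\<^bsub>PA\<^esub> g \<in> radical"
    and cycle_sum_mult_right: "cycle_sum V (f \<otimes>\<^bsub>PA\<^esub> g) = cycle_sum V f \<otimes> g (V, [])"
proof -
  note fc = radical_carrier[OF f]
  show "f \<otimes>\<^bsub>PA\<^esub> g \<in> radical"
  proof (rule radicalI)
    show "(f \<otimes>\<^bsub>PA\<^esub> g) (u, p) = \<zero>" if "(u, p) \<in> short" for u p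
      using that radical_zero[OF f] fc g by (subst PA_mult_eq_last) (auto simp: short_take)
  qed (simp add: fc g)
  have "(f \<otimes>\<^bsub>PA\<^esub> g) C = f C \<otimes> g (V, [])" if C: "C \<in> cycles_at V" for C
  proof -
    obtain c where c: "C = (V, c)" "(V, c) \<in> cycles_at V" using C by (auto elim: cycles_atE)
    then have "(f \<otimes>\<^bsub>PA\<^esub> g) (V, c) = f (V, c) \<otimes> g (awlast V c, [])"
      using fc g radical_zero[OF f cycle_take_short] by (intro PA_mult_eq_last) auto
    then show ?thesis using c cycle_path by simp
  qed
  then have "cycle_sum V (f \<otimes>\<^bsub>PA\<^esub> g) = (\<Oplus>C\<in>cycles_at V. f C \<otimes> g (V, []))"
    unfolding cycle_sum_def using fc g by (intro finsum_cong') auto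
  then show "cycle_sum V (f \<otimes>\<^bsub>PA\<^esub> g) = cycle_sum V f \<otimes> g (V, [])"
    using fc g finite_cycles_at by (simp add: cycle_sum_def finsum_ldistr Pi_def)
qed

text \<open>Mirror image: now \<open>g\<close> is read at the trivial path of the start of the
  cycle, which is \<open>V\<close> again. That the two sums agree makes \<open>radical\<close>
  central modulo \<open>J\<close>.\<close>

lemma
  assumes f: "f \<in> radical" and g: "g \<in> carrier PA"
  shows radical_mult_left: "g \<otimes>\<^bsub>PA\<^esub> f \<in> radical"
    and cycle_sum_mult_left: "cycle_sum V (g \<otimes>\<^bsub>PA\<^esub> f) = cycle_sum V f \<otimes> g (V, [])"
proof -
  note fc = radical_carrier[OF f]
  show "g \<otimes>\<^bsub>PA\<^esub> f \<in> radical"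
  proof (rule radicalI)
    show "(g \<otimes>\<^bsub>PA\<^esub> f) (u, p) = \<zero>" if "(u, p) \<in> short" for u p
      using that radical_zero[OF f] fc g by (subst PA_mult_eq_first) (auto simp: short_drop)
  qed (simp add: fc g)
  have "(g \<otimes>\<^bsub>PA\<^esub> f) C = f C \<otimes> g (V, [])" if C: "C \<in> cycles_at V" for C
  proof -
    obtain c where c: "C = (V, c)" "(V, c) \<in> cycles_at V" using C by (auto elim: cycles_atE)
    then have "(g \<otimes>\<^bsub>PA\<^esub> f) (V, c) = g (V, []) \<otimes> f (V, c)"
      using fc g radical_zero[OF f cycle_drop_short] by (intro PA_mult_eq_first) auto
    then show ?thesis using c fc g by (simp add: m_comm)
  qed
  then have "cycle_sum V (g \<otimes>\<^bsub>PA\<^esub> f) = (\<Oplus>C\<in>cycles_at V. f C \<otimes> g (V, []))"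
    unfolding cycle_sum_def using fc g by (intro finsum_cong') auto
  then show "cycle_sum V (g \<otimes>\<^bsub>PA\<^esub> f) = cycle_sum V f \<otimes> g (V, [])"
    using fc g finite_cycles_at by (simp add: cycle_sum_def finsum_ldistr Pi_def)
qed

lemma J_carrier: "f \<in> J \<Longrightarrow> f \<in> carrier PA"
  by (simp add: J_def radical_def)

lemma radical_central_mod:
  assumes "f \<in> radical" "g \<in> carrier PA" shows "f \<otimes>\<^bsub>PA\<^esub> g \<ominus>\<^bsub>PA\<^esub> g \<otimes>\<^bsub>PA\<^esub> f \<in> J"
proof -
  have "cycle_sum V (f \<otimes>\<^bsub>PA\<^esub> g \<ominus>\<^bsub>PA\<^esub> g \<otimes>\<^bsub>PA\<^esub> f) = \<zero>" for V
    using assms radical_carrier[OF assms(1)]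
    by (simp add: cycle_sum_minus cycle_sum_mult_left cycle_sum_mult_right r_right_minus_eq)
  then show ?thesis
    using assms radical_minus radical_mult_left radical_mult_right by (simp add: J_def)
qed

text \<open>Multiplication scales each \<open>cycle_sum V\<close> by one coefficient of the other
  factor, so its vanishing persists.\<close>

lemma J_ideal: "ideal J PA"
proof (rule idealI)
  show "subgroup J (add_monoid PA)"
  proof (rule A.add.subgroupI)
    have "\<zero>\<^bsub>PA\<^esub> \<in> J"
      by (simp add: J_def radical_def PA_zero cycle_sum_zero)
    then show "J \<noteq> {}" by blast
    show "\<ominus>\<^bsub>PA\<^esub> f \<in> J" if "f \<in> J" for f
      using that by (auto simp: J_def radical_def PA_uminus cycle_sum_uminus)
    show "f \<oplus>\<^bsub>PA\<^esub> g \<in> J" if "f \<in> J" "g \<in> J" for f g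
      using that by (auto simp: J_def radical_def PA_add cycle_sum_add)
  qed (use J_carrier in auto)
  show "g \<otimes>\<^bsub>PA\<^esub> f \<in> J" "f \<otimes>\<^bsub>PA\<^esub> g \<in> J" if "f \<in> J" "g \<in> carrier PA" for f g
    using that by (auto simp: J_def radical_mult_left radical_mult_right cycle_sum_mult_left cycle_sum_mult_right)
qed (rule A.ring_axioms)

lemma short_or_cycleE:
  assumes "(u, p) \<in> short \<or> (u, p) \<in> cycles_at V"
  obtains \<alpha> l k where "\<alpha> \<in> NT" "l < n \<alpha>" "k \<le> n \<alpha>" "p = track \<alpha> l k"
  using assms
proof
  assume "(u, p) \<in> short"
  then show thesis by (rule shortE) (rule that; simp)
next
  assume "(u, p) \<in> cycles_at V"
  then show thesis by (rule cycles_atE) (rule that; simp)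
qed

lemma path_elt_J:
  assumes path: "(u, p) \<in> quiver_paths Q"
    and long: "\<And>\<alpha> l k. \<lbrakk>\<alpha> \<in> NT; l < n \<alpha>; k \<le> n \<alpha>\<rbrakk> \<Longrightarrow> p \<noteq> track \<alpha> l k"
  shows "path_elt K (u, p) \<in> J"
proof -
  have x: "(u, p) \<notin> short" "(u, p) \<notin> cycles_at V" for V
    using short_or_cycleE[of u p V] long by metis+
  then have "cycle_sum V (path_elt K (u, p)) = \<zero>" for V
    by (intro cycle_sum_zero) (auto simp: path_elt_apply)
  then show ?thesis using x path by (auto simp: J_def radical_def path_elt_closed path_elt_apply)
qed

lemma
  assumes "C \<in> cycles_at V"
  shows cycle_closed: "path_elt K C \<in> carrier PA"
    and cycle_radical: "path_elt K C \<in> radical"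
    and cycle_sum_cycle: "cycle_sum W (path_elt K C) = (if W = V then \<one> else \<zero>)"
proof -
  obtain c where c: "C = (V, c)" using assms by (auto elim: cycles_atE)
  show cl: "path_elt K C \<in> carrier PA" using assms cycle_path c by (auto intro: path_elt_closed)
  show "path_elt K C \<in> radical"
    using cl cycle_not_short[OF assms] by (auto simp: radical_def path_elt_apply)
  show "cycle_sum W (path_elt K C) = (if W = V then \<one> else \<zero>)"
  proof (cases "W = V")
    case True
    then show ?thesis using cycle_sum_single[OF assms, of "path_elt K C"] by (simp add: path_elt_apply)
  next
    case False
    then show ?thesis
      using c by (auto intro!: cycle_sum_zero simp: path_elt_apply cycles_at_def)
  qed
qed

abbreviation rels where
  "rels \<equiv> relations_one K \<Gamma> \<union> relations_two K \<Gamma> \<union> relations_three K \<Gamma>"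

lemma cycle_power_eq:
  assumes "(\<alpha>, C) \<in> special_cycles \<Gamma>" shows "cycle_power K \<Gamma> \<alpha> C = path_elt K C"
proof -
  have "C \<in> cycles_at (fst C)" "mu \<Gamma> \<alpha> = 1"
    using assms mu_one by (auto simp: cycles_at_def special_cycles_iff nontruncated_def)
  then show ?thesis using cycle_closed by (auto simp: cycle_power_def A.nat_pow_Suc)
qed

text \<open>With \<mu> = 1 such a relation is one full turn followed by its first arrow again, hence
  a single path with one arrow more than a special cycle.\<close>

lemma relation_two_eq:
  assumes "\<alpha> \<in> NT" "l < n \<alpha>" "C = (s \<alpha> ! l, track \<alpha> l (n \<alpha>))"
  shows "cycle_power K \<Gamma> \<alpha> C \<otimes>\<^bsub>PA\<^esub> path_elt K (first_arrow C)
      = path_elt K (s \<alpha> ! l, track \<alpha> l (Suc (n \<alpha>)))"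
    and "(s \<alpha> ! l, track \<alpha> l (Suc (n \<alpha>))) \<in> quiver_paths Q"
proof -
  have C: "(\<alpha>, C) \<in> special_cycles \<Gamma>" "C \<in> cycles_at (s \<alpha> ! l)"
    using assms by (auto simp: special_cycles_iff cycles_at_def)
  have "hd (track \<alpha> l (n \<alpha>)) = (\<alpha>, l)"
    using assms val_ge_two[of \<alpha>] by (subst hd_conv_nth) (auto simp flip: length_greater_0_conv)
  then have f: "first_arrow C = (s \<alpha> ! l, [(\<alpha>, l)])" by (simp add: first_arrow_def assms(3))
  show p: "(s \<alpha> ! l, track \<alpha> l (Suc (n \<alpha>))) \<in> quiver_paths Q"
    using awalk_track[OF assms(1,2)] by (auto simp: quiver_paths_def)
  have t: "track \<alpha> l (Suc (n \<alpha>)) = track \<alpha> l (n \<alpha>) @ [(\<alpha>, l)]"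
    using assms(2) by (simp add: track_snoc)
  show "cycle_power K \<Gamma> \<alpha> C \<otimes>\<^bsub>PA\<^esub> path_elt K (first_arrow C)
      = path_elt K (s \<alpha> ! l, track \<alpha> l (Suc (n \<alpha>)))"
    using path_elt_mult[OF p[unfolded t]] cycle_path(2)[OF C(2)[unfolded assms(3)]]
    unfolding cycle_power_eq[OF C(1)] f t by (simp add: assms(3))
qed

lemma relations_J: "rels \<subseteq> J"
proof (intro Un_least subsetI)
  fix f assume "f \<in> relations_one K \<Gamma>"
  then obtain V \<alpha> \<beta> C D where f: "f = cycle_power K \<Gamma> \<alpha> C \<ominus>\<^bsub>PA\<^esub> cycle_power K \<Gamma> \<beta> D"
    and "(\<alpha>, C) \<in> special_cycles \<Gamma>" "fst C = V" "(\<beta>, D) \<in> special_cycles \<Gamma>" "fst D = V"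
    unfolding relations_one_def by blast
  then have C: "(\<alpha>, C) \<in> special_cycles \<Gamma>" "C \<in> cycles_at V"
    and D: "(\<beta>, D) \<in> special_cycles \<Gamma>" "D \<in> cycles_at V"
    by (auto simp: cycles_at_def)
  show "f \<in> J"
    using cycle_closed[OF C(2)] cycle_closed[OF D(2)] cycle_radical[OF C(2)] cycle_radical[OF D(2)]
    by (simp add: f cycle_power_eq[OF C(1)] cycle_power_eq[OF D(1)] J_def radical_minus cycle_sum_minus
        cycle_sum_cycle[OF C(2)] cycle_sum_cycle[OF D(2)] r_right_minus_eq)
next
  fix f assume "f \<in> relations_two K \<Gamma>"
  then obtain \<alpha> l where a: "\<alpha> \<in> NT" "l < n \<alpha>"
    and f: "f = path_elt K (s \<alpha> ! l, track \<alpha> l (Suc (n \<alpha>)))"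
    using relation_two_eq(1) by (auto simp: relations_two_def special_cycles_iff)
  \<comment> \<open>The first arrow fixes the vertex, so the length \<open>n \<alpha> + 1\<close>
    would have to be at most \<open>n \<alpha>\<close>.\<close>
  have "track \<alpha> l (Suc (n \<alpha>)) \<noteq> track \<beta> l' k" if "l' < n \<beta>" "k \<le> n \<beta>" for \<beta> l' k
  proof
    assume "track \<alpha> l (Suc (n \<alpha>)) = track \<beta> l' k"
    from track_eq_iff[OF this _ a(2) that(1)] that(2) show False by auto
  qed
  then show "f \<in> J" using relation_two_eq(2)[OF a] unfolding f by (intro path_elt_J) auto
next
  fix f assume "f \<in> relations_three K \<Gamma>"
  then obtain u a b where f: "f = path_elt K (u, [a, b])" and p: "(u, [a, b]) \<in> quiver_paths Q"
    and sub: "\<forall>(\<alpha>, C)\<in>special_cycles \<Gamma>. \<not> sublist [a, b] (snd C)"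
    unfolding relations_three_def by blast
  have "[a, b] \<noteq> track \<alpha> l k" if "\<alpha> \<in> NT" "l < n \<alpha>" "k \<le> n \<alpha>" for \<alpha> l k
  proof
    assume "[a, b] = track \<alpha> l k"
    \<comment> \<open>A track with at most \<open>n \<alpha>\<close> arrows is an initial piece of
      the special cycle from the same position, which type three rules out.\<close>
    then have "[a, b] = take k (track \<alpha> l (n \<alpha>))" using that by (simp add: take_track)
    then have "sublist [a, b] (track \<alpha> l (n \<alpha>))" by (metis sublist_take)
    moreover have "(\<alpha>, (s \<alpha> ! l, track \<alpha> l (n \<alpha>))) \<in> special_cycles \<Gamma>"
      using that by (auto simp: special_cycles_iff)
    ultimately show False using sub by fastforce
  qed
  then show "f \<in> J"
    unfolding f using p by (intro path_elt_J) auto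
qed

section \<open>The ideal of relations equals \<open>J\<close>\<close>

lemma relations_carrier: "rels \<subseteq> carrier PA"
  using relations_J J_carrier by blast

sublocale I: algebra_ideal K PA "Idl\<^bsub>PA\<^esub> rels"
  by (intro algebra_ideal.intro A.assoc_algebra_axioms A.genideal_ideal relations_carrier)

lemma ideal_subset_J: "Idl\<^bsub>PA\<^esub> rels \<subseteq> J"
  using A.genideal_minimal[OF J_ideal relations_J] .

lemma relations_mem: "f \<in> rels \<Longrightarrow> f \<in> Idl\<^bsub>PA\<^esub> rels"
  using A.genideal_self[OF relations_carrier] by blast

text \<open>If the first two arrows do not follow each other in a special cycle, a type three
  relation divides the path. Otherwise either the path without its first arrow is already in the
  ideal, or it is a track, and then the whole path is a track with exactly one arrow too many: a
  type two relation.\<close>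

lemma long_path_mem:
  assumes "(u, p) \<in> quiver_paths Q" "(u, p) \<notin> short" "(u, p) \<notin> cycles_at u"
  shows "path_elt K (u, p) \<in> Idl\<^bsub>PA\<^esub> rels"
  using assms
proof (induction p arbitrary: u)
  case Nil
  then show ?case using trivial_short[of u] by (auto simp: quiver_paths_iff awalk_Nil_iff)
next
  case (Cons a q)
  then obtain b p where q: "q = b # p" using arc_short by (cases q) auto
  define v where "v = awlast u [a]"
  have ua: "(u, [a]) \<in> quiver_paths Q" and vq: "(v, q) \<in> quiver_paths Q"
    using Cons.prems(1) quiver_paths_append[of u "[a]" q] by (simp_all add: v_def)
  show ?case
  proof (cases "\<exists>(\<alpha>, C)\<in>special_cycles \<Gamma>. sublist [a, b] (snd C)")
    case False
    have path: "(u, [a, b] @ p) \<in> quiver_paths Q" using Cons.prems(1) q by simp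
    then have ab: "(u, [a, b]) \<in> quiver_paths Q" and wp: "(awlast u [a, b], p) \<in> quiver_paths Q"
      by (simp_all only: quiver_paths_append)
    \<comment> \<open>The exception for squares of loops in type three is void, since valencies are
      at least two.\<close>
    have "\<not> (a = b \<and> (\<exists>\<alpha>\<in>NT. n \<alpha> = 1 \<and> mu \<Gamma> \<alpha> > 1 \<and> a = (\<alpha>, 0)))"
      using val_ge_two by fastforce
    moreover have "\<forall>(\<alpha>, C)\<in>special_cycles \<Gamma>. \<not> sublist [a, b] (snd C)" using False by blast
    ultimately have "path_elt K (u, [a, b]) \<in> relations_three K \<Gamma>"
      using ab unfolding relations_three_def by blast
    then have "path_elt K (u, [a, b]) \<otimes>\<^bsub>PA\<^esub> path_elt K (awlast u [a, b], p) \<in> Idl\<^bsub>PA\<^esub> rels"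
      using wp by (intro I.I_r_closed relations_mem path_elt_closed) auto
    then show ?thesis using path_elt_mult[OF path] q by simp
  next
    case True
    then obtain \<alpha> l where \<alpha>: "\<alpha> \<in> NT" "sublist [a, b] (track \<alpha> l (n \<alpha>))"
      by (auto simp: special_cycles_iff)
    then obtain j where a: "a = (\<alpha>, j)" "j < n \<alpha>" and b: "b = (\<alpha>, Suc j mod n \<alpha>)"
      using val_ge_two[OF \<alpha>(1)] by (auto elim!: sublist_track simp: mod_Suc_eq)
    show ?thesis
    proof (cases "(v, q) \<in> short \<or> (v, q) \<in> cycles_at v")
      case False
      then have "path_elt K (v, q) \<in> Idl\<^bsub>PA\<^esub> rels" using Cons.IH vq by blast
      then have "path_elt K (u, [a]) \<otimes>\<^bsub>PA\<^esub> path_elt K (v, q) \<in> Idl\<^bsub>PA\<^esub> rels"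
        using ua by (intro I.I_l_closed path_elt_closed)
      then show ?thesis using path_elt_mult[of u "[a]" q] Cons.prems(1) by (simp add: v_def)
    next
      case True
      then obtain \<beta> l' k where k: "\<beta> \<in> NT" "l' < n \<beta>" "k \<le> n \<beta>" "q = track \<beta> l' k"
        by (rule short_or_cycleE)
      then obtain k' where k': "k = Suc k'" using q by (cases k) auto
      \<comment> \<open>The shared arrow \<open>b\<close> forces the tail \<open>q\<close> to run
        round the same vertex \<open>\<alpha>\<close>, from the position after
        \<open>j\<close>.\<close>
      have "b = (\<beta>, l')" using q k k' by (simp add: track_Suc)
      then have "q = track \<alpha> (Suc j mod n \<alpha>) k" "k \<le> n \<alpha>" using k b by auto
      then have aq: "a # q = track \<alpha> j (Suc k)" using a by (simp add: track_Suc)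
      \<comment> \<open>Otherwise the whole path would be short or a special cycle. So the tail is a
        full turn.\<close>
      have "\<not> Suc k \<le> n \<alpha>"
        using Cons.prems short_or_cycle[OF _ \<alpha>(1) a(2), of u "Suc k"] unfolding aq by blast
      then have kn: "k = n \<alpha>" using \<open>k \<le> n \<alpha>\<close> by simp
      have u: "u = s \<alpha> ! j" using ua a by (auto simp: quiver_paths_iff awalk_def)
      have "path_elt K (u, a # q) \<in> relations_two K \<Gamma>"
        unfolding aq u kn relation_two_eq(1)[OF \<alpha>(1) a(2) refl, symmetric]
        using \<alpha>(1) a(2) by (auto simp: relations_two_def special_cycles_iff)
      then show ?thesis by (intro relations_mem) auto
    qed
  qed
qed

lemma special_cycle_mem:
  assumes "(\<alpha>, C) \<in> special_cycles \<Gamma>" shows "\<alpha> \<in># elts \<Gamma> (fst C)"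
proof -
  obtain l where l: "\<alpha> \<in> NT" "l < n \<alpha>" "fst C = s \<alpha> ! l"
    using assms by (auto simp: special_cycles_iff)
  then have "fst C \<in> set (s \<alpha>)" using length_succ_seq[of \<alpha>] by simp
  then show ?thesis using set_succ_seq[OF l(1)] by blast
qed

text \<open>Induction on the number of paths in the support other than the \<open>e\<close>-cycles.
  Long paths are subtracted outright, and other special cycles are traded for the
  \<open>e\<close>-cycle at the same polygon. What remains has one coefficient per polygon, equal to
  a \<open>cycle_sum\<close> and hence zero.\<close>

lemma J_subset_ideal: "f \<in> J \<Longrightarrow> f \<in> Idl\<^bsub>PA\<^esub> rels"
proof (induction "card {x. f x \<noteq> \<zero> \<and> (e, x) \<notin> special_cycles \<Gamma>}" arbitrary: f rule: less_induct)
  case less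
  have fc: "f \<in> carrier PA" using less.prems by (rule J_carrier)
  have fin: "finite {x. f x \<noteq> \<zero> \<and> (e, x) \<notin> special_cycles \<Gamma>}"
    using PA_finite[OF fc] by (rule rev_finite_subset) auto
  text \<open>Subtracting a multiple of an element of the ideal removes \<open>x\<close> from the support.\<close>
  have step: ?case
    if x: "f x \<noteq> \<zero>" "(e, x) \<notin> special_cycles \<Gamma>" and r: "r \<in> Idl\<^bsub>PA\<^esub> rels" "r x = \<one>"
      and supp: "\<And>y. \<lbrakk>y \<noteq> x; (e, y) \<notin> special_cycles \<Gamma>\<rbrakk> \<Longrightarrow> r y = \<zero>" for x r
  proof -
    define t where "t = f x \<odot>\<^bsub>PA\<^esub> r"
    have rc: "r \<in> carrier PA" using r(1) I.a_subset by blast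
    have t: "t \<in> Idl\<^bsub>PA\<^esub> rels" unfolding t_def using fc r by (intro I.smult_mem) auto
    have tc: "t \<in> carrier PA" using t I.a_subset by blast
    define g where "g = f \<ominus>\<^bsub>PA\<^esub> t"
    have g: "g y = f y \<ominus> f x \<otimes> r y" for y
      using fc tc rc by (simp add: g_def PA_minus) (simp add: t_def PA_smult)
    have "{y. g y \<noteq> \<zero> \<and> (e, y) \<notin> special_cycles \<Gamma>} \<subset> {y. f y \<noteq> \<zero> \<and> (e, y) \<notin> special_cycles \<Gamma>}"
    proof (rule psubsetI)
      show "{y. g y \<noteq> \<zero> \<and> (e, y) \<notin> special_cycles \<Gamma>} \<subseteq> {y. f y \<noteq> \<zero> \<and> (e, y) \<notin> special_cycles \<Gamma>}"
      proof (intro Collect_mono impI conjI)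
        fix y assume y: "g y \<noteq> \<zero> \<and> (e, y) \<notin> special_cycles \<Gamma>"
        show "f y \<noteq> \<zero>"
        proof
          assume "f y = \<zero>"
          then have "g y = \<zero>" using x y fc supp[of y] by (cases "y = x") (simp_all add: g minus_eq)
          then show False using y by simp
        qed
      qed auto
      have "g x = \<zero>" using fc r by (simp add: g r_right_minus_eq)
      then show "{y. g y \<noteq> \<zero> \<and> (e, y) \<notin> special_cycles \<Gamma>} \<noteq> {y. f y \<noteq> \<zero> \<and> (e, y) \<notin> special_cycles \<Gamma>}"
        using x by blast
    qed
    then have "card {y. g y \<noteq> \<zero> \<and> (e, y) \<notin> special_cycles \<Gamma>} < card {y. f y \<noteq> \<zero> \<and> (e, y) \<notin> special_cycles \<Gamma>}"
      using fin by (rule psubset_card_mono[rotated])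
    moreover have "g \<in> J"
      using less.prems t ideal_subset_J additive_subgroup.a_closed[OF ideal.axioms(1)[OF J_ideal]]
        additive_subgroup.a_inv_closed[OF ideal.axioms(1)[OF J_ideal]]
      by (auto simp: g_def a_minus_def)
    ultimately have "g \<in> Idl\<^bsub>PA\<^esub> rels" by (rule less.hyps)
    moreover have "f = g \<oplus>\<^bsub>PA\<^esub> t" using fc tc by (simp add: g_def a_minus_def A.a_assoc A.l_neg)
    ultimately show ?case using t by simp
  qed
  show ?case
  proof (cases "\<exists>x. f x \<noteq> \<zero> \<and> (e, x) \<notin> special_cycles \<Gamma>")
    case True
    then obtain u p where x: "f (u, p) \<noteq> \<zero>" "(e, (u, p)) \<notin> special_cycles \<Gamma>" by auto
    then have path: "(u, p) \<in> quiver_paths Q" using PA_coeff_zero[OF fc] by blast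
    then have u: "u \<in> polygons \<Gamma>" by (auto simp: quiver_paths_iff awalk_def)
    have ns: "(u, p) \<notin> short" using x less.prems by (auto simp: J_def radical_zero)
    show ?thesis
    proof (cases "(u, p) \<in> cycles_at u")
      case False
      then have "path_elt K (u, p) \<in> Idl\<^bsub>PA\<^esub> rels" using long_path_mem path ns by blast
      then show ?thesis by (rule step[OF x]) (simp_all add: path_elt_apply)
    next
      case True
      then obtain \<alpha> where \<alpha>: "(\<alpha>, (u, p)) \<in> special_cycles \<Gamma>" by (auto simp: cycles_at_def)
      let ?r = "path_elt K (u, p) \<ominus>\<^bsub>PA\<^esub> path_elt K (apex_cycle u)"
      note ac = apex_cycle_special[OF u] fst_apex_cycle[OF u] apex_cycle_at[OF u]
      have "\<alpha> \<in># elts \<Gamma> u" using special_cycle_mem[OF \<alpha>] by simp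
      then have "cycle_power K \<Gamma> \<alpha> (u, p) \<ominus>\<^bsub>PA\<^esub> cycle_power K \<Gamma> e (apex_cycle u) \<in> relations_one K \<Gamma>"
        unfolding relations_one_def using u apex_mem[OF u] \<alpha> ac fst_conv[of u p] by blast
      then have "?r \<in> relations_one K \<Gamma>" by (simp only: cycle_power_eq[OF \<alpha>] cycle_power_eq[OF ac(1)])
      then have "?r \<in> Idl\<^bsub>PA\<^esub> rels" by (intro relations_mem) auto
      moreover have r: "?r y = path_elt K (u, p) y \<ominus> path_elt K (apex_cycle u) y" for y
        using cycle_closed[OF True] cycle_closed[OF ac(3)] by (simp add: PA_minus)
      ultimately show ?thesis
        using x ac(1) by (intro step[OF x, of ?r]) (auto simp: r path_elt_apply minus_eq)
    qed
  next
    case False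
    have "f x = \<zero>" for x
    proof (rule ccontr)
      assume x: "f x \<noteq> \<zero>"
      then have e: "(e, x) \<in> special_cycles \<Gamma>" using False by blast
      have V: "fst x \<in> polygons \<Gamma>" using e by (auto simp: special_cycles_iff succ_seq_in_polygons)
      have "cycle_sum (fst x) f = f x"
      proof (rule cycle_sum_single)
        show "x \<in> cycles_at (fst x)" using e by (auto simp: cycles_at_def)
        fix D assume D: "D \<in> cycles_at (fst x)" "D \<noteq> x"
        then have "fst D = fst x" by (simp add: cycles_at_def)
        then have "(e, D) \<notin> special_cycles \<Gamma>"
          using D(2) apex_cycle_eqI[OF V e refl] apex_cycle_eqI[OF V] by metis
        then show "f D = \<zero>" using False by blast
      qed (simp add: fc)
      then show False using x less.prems V by (simp add: J_def)
    qed
    then have "f = \<zero>\<^bsub>PA\<^esub>" by (simp add: fun_eq_iff PA_zero)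
    then show ?thesis by simp
  qed
qed

lemma ideal_eq_J: "Idl\<^bsub>PA\<^esub> rels = J"
  using ideal_subset_J J_subset_ideal by blast

subsection \<open>The center\<close>

lemma central_mod_coeffs:
  assumes z: "z \<in> carrier PA" and comm: "\<And>x. x \<in> carrier PA \<Longrightarrow> z \<otimes>\<^bsub>PA\<^esub> x \<ominus>\<^bsub>PA\<^esub> x \<otimes>\<^bsub>PA\<^esub> z \<in> J"
  shows "\<lbrakk>(u, p) \<in> short; p \<noteq> []\<rbrakk> \<Longrightarrow> z (u, p) = \<zero>"
    and "V \<in> polygons \<Gamma> \<Longrightarrow> z (V, []) = z (s e ! 0, [])"
proof -
  \<comment> \<open>Elements of \<open>J\<close> vanish on short paths, so there both products have
    the same coefficients.\<close>
  have eq: "(z \<otimes>\<^bsub>PA\<^esub> x) y = (x \<otimes>\<^bsub>PA\<^esub> z) y" if "x \<in> carrier PA" "y \<in> short" for x y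
  proof -
    have "(z \<otimes>\<^bsub>PA\<^esub> x \<ominus>\<^bsub>PA\<^esub> x \<otimes>\<^bsub>PA\<^esub> z) y = \<zero>"
      using comm[OF that(1)] that(2) by (simp add: J_def radical_zero)
    then show ?thesis using that z by (simp add: PA_minus r_right_minus_eq)
  qed
  show "z (u, p) = \<zero>" if p: "(u, p) \<in> short" "p \<noteq> []" for u p
  proof -
    have "(u, []) \<in> quiver_paths Q" using p quiver_paths_take[of u p 0] by (auto elim: shortE)
    then have x: "path_elt K (u, []) \<in> carrier PA" by (rule path_elt_closed)
    \<comment> \<open>The trivial path at \<open>u\<close> keeps what starts there when multiplied
      from the left and what ends there from the right; a nontrivial short path from
      \<open>u\<close> does not end at \<open>u\<close>.\<close>
    have "(path_elt K (u, []) \<otimes>\<^bsub>PA\<^esub> z) (u, p) = z (u, p)"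
      using x z p by (subst PA_mult_eq_first) (auto simp: path_elt_apply)
    moreover have "(z \<otimes>\<^bsub>PA\<^esub> path_elt K (u, [])) (u, p) = \<zero>"
      using x z p short_closed_trivial[OF p(1)] by (subst PA_mult_eq_last) (auto simp: path_elt_apply)
    ultimately show ?thesis using eq[OF x p(1)] by simp
  qed
  \<comment> \<open>Read at an arrow of \<open>e\<close>, the two products are the coefficients of
    \<open>z\<close> at the trivial paths of its two ends. Moving from position to position reaches
    every polygon.\<close>
  have step: "z (s e ! j, []) = z (s e ! (Suc j mod n e), [])" if j: "j < n e" for j
  proof -
    let ?u = "s e ! j" and ?a = "(e, j)"
    have path: "(?u, [?a]) \<in> quiver_paths Q"
      using j apex_nontruncated by (auto simp: quiver_paths_iff awalk_def succ_seq_in_polygons)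
    then have x: "path_elt K (?u, [?a]) \<in> carrier PA" by (rule path_elt_closed)
    have "(z \<otimes>\<^bsub>PA\<^esub> path_elt K (?u, [?a])) (?u, [?a]) = z (?u, [])"
      using x z by (subst PA_mult_eq_first) (auto simp: path_elt_apply)
    moreover have "(path_elt K (?u, [?a]) \<otimes>\<^bsub>PA\<^esub> z) (?u, [?a]) = z (s e ! (Suc j mod n e), [])"
      using x z by (subst PA_mult_eq_last) (auto simp: path_elt_apply)
    ultimately show ?thesis using eq[OF x arc_short[OF path]] by simp
  qed
  have "z (s e ! j, []) = z (s e ! 0, [])" if "j < n e" for j
    using that
  proof (induction j)
    case (Suc j)
    then show ?case using step[of j] by simp
  qed simp
  then show "z (V, []) = z (s e ! 0, [])" if "V \<in> polygons \<Gamma>"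
    using that set_succ_seq_apex length_succ_seq[OF apex_nontruncated] by (metis in_set_conv_nth)
qed

theorem has_dim_center:
  "has_dim K (brauer_algebra K \<Gamma>) (algebra_center (brauer_algebra K \<Gamma>)) (Suc (card (polygons \<Gamma>)))"
proof -
  let ?V0 = "s e ! 0"
  \<comment> \<open>\<open>None\<close> indexes the unit and \<open>Some V\<close> the common class
    of the special cycles at \<open>V\<close>. Any polygon could replace \<open>?V0\<close>, since
    an element central modulo \<open>J\<close> has the same coefficient at all trivial
    paths.\<close>
  define b where "b i = (case i of None \<Rightarrow> \<one>\<^bsub>PA\<^esub> | Some V \<Rightarrow> path_elt K (apex_cycle V))" for i
  define \<phi> where "\<phi> i f = (case i of None \<Rightarrow> f (?V0, []) | Some V \<Rightarrow> cycle_sum V f)" for i and f :: "'i \<times> ('a \<times> nat) list \<Rightarrow> 'k"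
  let ?I = "insert None (Some ` polygons \<Gamma>)"
  have V0: "?V0 \<in> polygons \<Gamma>"
    using val_ge_two[OF apex_nontruncated] by (intro succ_seq_in_polygons apex_nontruncated) simp
  \<comment> \<open>The unit is supported on trivial paths, which are short, so its cycle
    coordinates vanish.\<close>
  have one_sum: "cycle_sum V \<one>\<^bsub>PA\<^esub> = \<zero>" for V
  proof (rule cycle_sum_zero)
    fix C assume C: "C \<in> cycles_at V"
    then show "\<one>\<^bsub>PA\<^esub> C = \<zero>"
      using cycle_not_short[OF C] trivial_short by (cases C) (auto simp: PA_one)
  qed
  have cycle_V0: "path_elt K (apex_cycle V) (?V0, []) = \<zero>" if "V \<in> polygons \<Gamma>" for V
    using cycle_radical[OF apex_cycle_at[OF that]] trivial_short[OF V0] by (rule radical_zero)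
  have "has_dim K I.Q (algebra_center I.Q) (card ?I)"
  proof (rule I.has_dim_center_by_coordinates[where b = b and \<phi> = \<phi>])
    show "\<one> \<noteq> \<zero>" by simp
    show "finite ?I" by (simp add: finite_polygons)
    show "b i \<in> {z \<in> carrier PA. \<forall>x\<in>carrier PA. z \<otimes>\<^bsub>PA\<^esub> x \<ominus>\<^bsub>PA\<^esub> x \<otimes>\<^bsub>PA\<^esub> z \<in> Idl\<^bsub>PA\<^esub> rels}"
      if "i \<in> ?I" for i
    proof (cases i)
      case None
      then show ?thesis by (simp add: b_def a_minus_def A.r_neg)
    next
      case (Some V)
      then have V: "apex_cycle V \<in> cycles_at V" using that apex_cycle_at by auto
      then show ?thesis
        using cycle_closed[OF V] radical_central_mod[OF cycle_radical[OF V]]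
        by (simp add: b_def Some ideal_eq_J)
    qed
    show "\<phi> i f \<in> carrier K" if "i \<in> ?I" "f \<in> carrier PA" for i f
      using that by (auto simp: \<phi>_def)
    show "\<phi> i (f \<oplus>\<^bsub>PA\<^esub> g) = \<phi> i f \<oplus> \<phi> i g" if "i \<in> ?I" "f \<in> carrier PA" "g \<in> carrier PA" for i f g
      using that by (auto simp: \<phi>_def PA_add cycle_sum_add)
    show "\<phi> i (c \<odot>\<^bsub>PA\<^esub> f) = c \<otimes> \<phi> i f" if "i \<in> ?I" "c \<in> carrier K" "f \<in> carrier PA" for i c f
      using that by (auto simp: \<phi>_def PA_smult cycle_sum_smult)
    show "\<phi> i (b j) = (if i = j then \<one> else \<zero>)" if "i \<in> ?I" "j \<in> ?I" for i j
      using that V0 by (auto simp: \<phi>_def b_def one_sum cycle_V0 PA_one cycle_sum_cycle[OF apex_cycle_at]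
          split: if_splits)
    show "z \<in> Idl\<^bsub>PA\<^esub> rels \<longleftrightarrow> (\<forall>i\<in>?I. \<phi> i z = \<zero>)"
      if "z \<in> {z \<in> carrier PA. \<forall>x\<in>carrier PA. z \<otimes>\<^bsub>PA\<^esub> x \<ominus>\<^bsub>PA\<^esub> x \<otimes>\<^bsub>PA\<^esub> z \<in> Idl\<^bsub>PA\<^esub> rels}" for z
    proof -
      have z: "z \<in> carrier PA" "\<And>x. x \<in> carrier PA \<Longrightarrow> z \<otimes>\<^bsub>PA\<^esub> x \<ominus>\<^bsub>PA\<^esub> x \<otimes>\<^bsub>PA\<^esub> z \<in> J"
        using that unfolding ideal_eq_J by auto
      \<comment> \<open>For \<open>z\<close> central modulo \<open>J\<close> this one coefficient
        controls those at all short paths, so it alone decides membership in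
        \<open>radical\<close>.\<close>
      have "z \<in> radical" if "z (?V0, []) = \<zero>"
      proof (rule radicalI[OF z(1)])
        fix u p assume up: "(u, p) \<in> short"
        then have "u \<in> polygons \<Gamma>" by (auto simp: quiver_paths_iff awalk_def elim!: shortE)
        then show "z (u, p) = \<zero>" using central_mod_coeffs[OF z] up that by (cases "p = []") auto
      qed
      then show ?thesis
        using trivial_short[OF V0] by (auto simp: ideal_eq_J J_def \<phi>_def radical_zero)
    qed
  qed
  then show ?thesis
    by (simp add: brauer_algebra_def card_image finite_polygons)
qed

end

section \<open>Groups of prime order\<close>

lemma UP_carrier: "carrier (UP R) = up R"
  by (simp add: UP_def)

lemma UP_coeff: "f \<in> carrier (UP R) \<Longrightarrow> up_ring.coeff (UP R) f n = f n"
  by (simp add: UP_def)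

context UP_cring
begin

lemma UP_assoc_algebra: "assoc_algebra R P"
proof (intro assoc_algebra.intro assoc_algebra_axioms.intro)
  show "x \<otimes>\<^bsub>P\<^esub> (c \<odot>\<^bsub>P\<^esub> y) = c \<odot>\<^bsub>P\<^esub> (x \<otimes>\<^bsub>P\<^esub> y)"
    if "c \<in> carrier R" "x \<in> carrier P" "y \<in> carrier P" for c x y
    using that UP_smult_assoc2[of c y x] by (simp add: P.m_comm)
qed (simp_all add: R_cring P.ring_axioms UP_smult_l_distr UP_smult_assoc2)

lemma coeff_mult_monom_two:
  assumes "g \<in> carrier P"
  shows "up_ring.coeff P (g \<otimes>\<^bsub>P\<^esub> up_ring.monom P \<one> 2) n = (if 2 \<le> n then up_ring.coeff P g (n - 2) else \<zero>)"
proof -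
  have "up_ring.coeff P (g \<otimes>\<^bsub>P\<^esub> up_ring.monom P \<one> 2) n
      = (\<Oplus>i\<in>{..n}. if n - i = 2 then up_ring.coeff P g i else \<zero>)"
    unfolding coeff_mult[OF assms monom_closed[OF R.one_closed]] coeff_monom[OF R.one_closed]
    by (rule R.finsum_cong') (use assms in auto)
  also have "\<dots> = (if 2 \<le> n then up_ring.coeff P g (n - 2) else \<zero>)"
  proof (cases "2 \<le> n")
    case True
    then show ?thesis using assms by (subst R.finsum_eq_single[of _ "n - 2"]) auto
  next
    case False
    then have "n - i \<noteq> 2" for i by linarith
    then show ?thesis using False by simp
  qed
  finally show ?thesis .
qed

lemma ideal_monom_two:
  "Idl\<^bsub>P\<^esub> {up_ring.monom P \<one> 2} = {f \<in> carrier P. up_ring.coeff P f 0 = \<zero> \<and> up_ring.coeff P f 1 = \<zero>}"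
proof -
  have "f \<in> PIdl\<^bsub>P\<^esub> (up_ring.monom P \<one> 2)"
    if f: "f \<in> carrier P" "up_ring.coeff P f 0 = \<zero>" "up_ring.coeff P f 1 = \<zero>" for f
  proof -
    \<comment> \<open>Dividing by the square of the variable shifts the coefficients down by
      two.\<close>
    define g where "g = (\<lambda>n. f (Suc (Suc n)))"
    \<comment> \<open>\<open>up_ring.coeff\<close> is a restricted function and is identified with
      application only on the carrier.\<close>
    have coeff: "up_ring.coeff P h n = h n" if "h \<in> carrier P" for h n
      using that unfolding P_def by (rule UP_coeff)
    have fu: "f \<in> up R" using f(1) unfolding P_def UP_carrier .
    then obtain N where N: "bound \<zero> N f" by (auto simp: up_def)
    have g_apply: "g k = f (Suc (Suc k))" for k by (simp add: g_def)
    have "bound \<zero> N g" using N by (auto simp: g_def bound_def)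
    then have "g \<in> up R" using fu by (auto simp: g_def up_def)
    then have g: "g \<in> carrier P" unfolding P_def UP_carrier .
    have "f = g \<otimes>\<^bsub>P\<^esub> up_ring.monom P \<one> 2"
    proof (rule up_eqI)
      show "up_ring.coeff P f n = up_ring.coeff P (g \<otimes>\<^bsub>P\<^esub> up_ring.monom P \<one> 2) n" for n
      proof -
        consider "n = 0" | "n = 1" | k where "n = Suc (Suc k)" by (metis One_nat_def not0_implies_Suc)
        then show ?thesis
          using f unfolding coeff_mult_monom_two[OF g]
          by cases (auto simp: coeff[OF f(1)] coeff[OF g] g_apply)
      qed
    qed (use f g in auto)
    then show ?thesis using g by (auto simp: cgenideal_def)
  qed
  then show ?thesis
    using coeff_mult_monom_two
    by (auto simp: P.cgenideal_eq_genideal[symmetric] cgenideal_def)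
qed

end

text \<open>Polynomials commute, so everything is central modulo the ideal; the coefficients in
  degrees 0 and 1 are coordinates dual to the first two powers of the variable.\<close>

lemma has_dim_center_poly_mod_square:
  assumes "field K"
  shows "has_dim K (poly_mod_square K) (algebra_center (poly_mod_square K)) 2"
proof -
  interpret K: field K by fact
  interpret UP_cring K "UP K" by unfold_locales auto
  let ?A = "UP K" and ?J = "Idl\<^bsub>UP K\<^esub> {up_ring.monom (UP K) \<one>\<^bsub>K\<^esub> 2}"
  interpret I: algebra_ideal K ?A ?J
    by (intro algebra_ideal.intro UP_assoc_algebra P.genideal_ideal) simp
  have "has_dim K I.Q (algebra_center I.Q) (card {0, 1 :: nat})"
  proof (rule I.has_dim_center_by_coordinates
      [where b = "up_ring.monom (UP K) \<one>\<^bsub>K\<^esub>" and \<phi> = "\<lambda>i f. up_ring.coeff (UP K) f i"])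
    show "up_ring.monom ?A \<one>\<^bsub>K\<^esub> i \<in> {z \<in> carrier ?A. \<forall>x\<in>carrier ?A. z \<otimes>\<^bsub>?A\<^esub> x \<ominus>\<^bsub>?A\<^esub> x \<otimes>\<^bsub>?A\<^esub> z \<in> ?J}" for i
      by (auto simp: P.m_comm a_minus_def P.r_neg)
    show "f \<in> ?J \<longleftrightarrow> (\<forall>i\<in>{0, 1}. up_ring.coeff ?A f i = \<zero>\<^bsub>K\<^esub>)"
      if "f \<in> {z \<in> carrier ?A. \<forall>x\<in>carrier ?A. z \<otimes>\<^bsub>?A\<^esub> x \<ominus>\<^bsub>?A\<^esub> x \<otimes>\<^bsub>?A\<^esub> z \<in> ?J}" for f
    proof -
      have "f \<in> carrier ?A" using that by blast
      then show ?thesis unfolding ideal_monom_two by simp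
    qed
  qed (auto simp: K.one_not_zero)
  then show ?thesis by (simp add: poly_mod_square_def numeral_2_eq_2)
qed

section \<open>Counting subgroups\<close>

lemma (in group) subgroup_eq_trivial_or_carrier:
  assumes "Factorial_Ring.prime (order G)" "subgroup H G"
  shows "H = {\<one>} \<or> H = carrier G"
proof -
  \<comment> \<open>An infinite group has \<open>order\<close> zero, which is not prime.\<close>
  have fin: "finite (carrier G)"
    using assms(1) prime_gt_0_nat[of "order G"] order_gt_0_iff_finite by simp
  have "card H dvd order G" by (subst lagrange[OF assms(2), symmetric]) simp
  then have "card H = 1 \<or> card H = order G" using assms(1) prime_nat_iff by blast
  then show ?thesis
  proof
    assume "card H = 1"
    then obtain x where "H = {x}" by (rule card_1_singletonE)
    then show ?thesis using subgroup.one_closed[OF assms(2)] by simp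
  next
    assume "card H = order G"
    then show ?thesis using card_subset_eq[OF fin subgroup.subset[OF assms(2)]] by (simp add: order_def)
  qed
qed

lemma (in group) subgroup_occ_one_prime:
  assumes "Factorial_Ring.prime (order G)" shows "subgroup_occ G \<one> = 2"
proof -
  have "{H. subgroup H G \<and> \<one> \<in> H} = {{\<one>}, carrier G}"
    using subgroup_eq_trivial_or_carrier[OF assms] triv_subgroup subgroup_self by auto
  moreover have "{\<one>} \<noteq> carrier G"
  proof
    assume "{\<one>} = carrier G"
    then have "order G = card {\<one>}" by (simp only: order_def)
    then show False using assms by simp
  qed
  ultimately show ?thesis by (simp add: subgroup_occ_def)
qed

text \<open>The trivial subgroup is the only one that is not a polygon; it matches the unit in the
  basis of the center.\<close>

lemma (in group) subgroup_occ_one_eq: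
  assumes "finite (carrier G)"
  shows "subgroup_occ G \<one> = Suc (card {H. subgroup H G \<and> H \<noteq> {\<one>}})"
proof -
  have "{H. subgroup H G \<and> H \<noteq> {\<one>}} \<subseteq> Pow (carrier G)"
    by (auto dest: subgroup.mem_carrier)
  then have "finite {H. subgroup H G \<and> H \<noteq> {\<one>}}" by (rule finite_subset) (simp add: assms)
  moreover have "{H. subgroup H G \<and> \<one> \<in> H} = insert {\<one>} {H. subgroup H G \<and> H \<noteq> {\<one>}}"
    using triv_subgroup subgroup.one_closed by auto
  ultimately show ?thesis by (simp add: subgroup_occ_def)
qed

lemma (in group) group_config_multiplicity_free:
  assumes fin: "finite (carrier G)" and mu: "\<And>x. x \<in> carrier G \<Longrightarrow> \<mu> x = 1"
    and \<Gamma>: "\<Gamma> \<in> group_configs G \<mu>" and np: "\<not> Factorial_Ring.prime (order G)"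
  shows "multiplicity_free_configuration \<Gamma> \<one>"
proof -
  have v: "vertices \<Gamma> = carrier G" and p: "polygons \<Gamma> = {H. subgroup H G \<and> H \<noteq> {\<one>}}"
    and e: "\<And>H. H \<in> polygons \<Gamma> \<Longrightarrow> elts \<Gamma> H = mset_set H"
    and m: "\<And>x. x \<in> carrier G \<Longrightarrow> mu \<Gamma> x = 1"
    and b: "brauer_configuration \<Gamma>"
    using \<Gamma> np mu by (auto simp: group_configs_def)
  have "\<one> \<in># elts \<Gamma> H" if "H \<in> polygons \<Gamma>" for H
  proof -
    have H: "subgroup H G" using that p by simp
    \<comment> \<open>\<open>mset_set\<close> of an infinite set is empty, so finiteness is what
      puts the identity into the multiset.\<close>
    then have "finite H" using fin subgroup.subset finite_subset by blast
    then show ?thesis using e[OF that] subgroup.one_closed[OF H] by simp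
  qed
  moreover have "count (elts \<Gamma> H) x \<le> 1" if "H \<in> polygons \<Gamma>" for H x
    by (simp add: e[OF that] count_mset_set')
  ultimately show ?thesis
    using v m
    by (intro multiplicity_free_configuration.intro multiplicity_free_configuration_axioms.intro b) auto
qed

theorem theorem6p3:
  fixes K :: "('k, 'l) ring_scheme" and G :: "('a, 'n) monoid_scheme"
    and \<mu> :: "'a \<Rightarrow> nat" and \<Gamma> :: "('a, 'a set) brauer_config"
  assumes "field K"
    and "group G" and "finite (carrier G)" and "carrier G \<noteq> {\<one>\<^bsub>G\<^esub>}"
    and "\<And>x. x \<in> carrier G \<Longrightarrow> \<mu> x = 1"
    and "\<Gamma> \<in> group_configs G \<mu>"
  shows "if Factorial_Ring.prime (order G)
    then has_dim K (poly_mod_square K) (algebra_center (poly_mod_square K)) (subgroup_occ G \<one>\<^bsub>G\<^esub>)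
    else has_dim K (brauer_algebra K \<Gamma>) (algebra_center (brauer_algebra K \<Gamma>)) (subgroup_occ G \<one>\<^bsub>G\<^esub>)"
proof (cases "Factorial_Ring.prime (order G)")
  case True
  then show ?thesis
    using has_dim_center_poly_mod_square[OF assms(1)] group.subgroup_occ_one_prime[OF assms(2)] by simp
next
  case False
  have dim: "has_dim K (brauer_algebra K \<Gamma>) (algebra_center (brauer_algebra K \<Gamma>)) (Suc (card (polygons \<Gamma>)))"
    using assms(1) group.group_config_multiplicity_free[OF assms(2,3,5,6) False]
    by (intro multiplicity_free_algebra.has_dim_center multiplicity_free_algebra.intro)
  have "polygons \<Gamma> = {H. subgroup H G \<and> H \<noteq> {\<one>\<^bsub>G\<^esub>}}"
    using assms(6) False by (simp add: group_configs_def)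
  then show ?thesis
    using dim False group.subgroup_occ_one_eq[OF assms(2,3)] by simp
qed

end
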